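(* Let $\{\mu_j\}_{j\ge1}$, $\{\gamma_j\}_{j\ge1}$, $\{\nu_j\}_{j\ge1}$ be sequences of real-valued random variables on a probability space $(\Omega,\mathcal{M},\mathbb{P})$, with $\mu_j\neq0$ for all $j$, and let $H_n$, $\tau_t^n$ and $M^{(n)}$ ($n\ge1$) be the associated anisotropic xy Hamiltonians, Heisenberg dynamics and effective one-particle $2n\times 2n$ matrices. Assume that the matrices $M^{(n)}$ are dynamically localized, with constants $C>0$ and $\eta>0$. Then there are numbers $C'>0$ and $\eta>0$ such that for any integers $1\le j<k$ and any $n\ge k$, the bound $$\mathbb{E}\left(\sup_{t\in\mathbb{R}}\left\|\left[\tau_t^n(A),B\right]\right\|\right)\le C'\,\|A\|\,\|B\|\,e^{-\eta|k-j|}$$ holds for all $A\in\mathcal{A}_j$ and $B\in\mathcal{A}_{[k,n]}$. In fact, with $C$ and $\eta$ the constants from the dynamical localization of $M^{(n)}$, one may choose the same exponent $\eta$ and $$C'=\frac{96\,C}{(1-e^{-\eta})^2}.$$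
   Context: Anisotropic xy chain with free boundary conditions: on $\mathcal{H}_{[1,n]}=\bigotimes_{j=1}^n\mathbb{C}^2$, $$H_n=\sum_{j=1}^{n-1}\mu_j\left[(1+\gamma_j)\sigma_j^x\sigma_{j+1}^x+(1-\gamma_j)\sigma_j^y\sigma_{j+1}^y\right]+\sum_{j=1}^n\nu_j\sigma_j^z,$$ where $\sigma^x=\begin{pmatrix}0&1\\1&0\end{pmatrix}$, $\sigma^y=\begin{pmatrix}0&-i\\i&0\end{pmatrix}$, $\sigma^z=\begin{pmatrix}1&0\\0&-1\end{pmatrix}$ and $\sigma_j^w$ acts as $\sigma^w$ on the $j$-th tensor factor and as the identity on the others. The Heisenberg dynamics is $\tau_t^n(A)=e^{itH_n}Ae^{-itH_n}$. For a set $J$ of sites in $[1,n]=\{1,\dots,n\}$, $\mathcal{A}_J$ denotes the algebra of operators on $\bigotimes_{j\in J}\mathbb{C}^2$, regarded as operators on $\mathcal{H}_{[1,n]}$ by tensoring with the identity; $\mathcal{A}_j=\mathcal{A}_{\{j\}}$ and $[k,n]=\{k,\dots,n\}$. $\|\cdot\|$ is the operator norm, $[\cdot,\cdot]$ the commutator, and $\mathbb{E}(X)=\int_\Omega X\,d\mathbb{P}$. The observables $A,B$ are non-random. Effective one-particle matrix: $M^{(n)}$ is the real symmetric $2n\times2n$ block matrix $$M^{(n)}=\begin{pmatrix}A^{(n)}&B^{(n)}\\-B^{(n)}&-A^{(n)}\end{pmatrix},$$ where $A^{(n)}$ is the symmetric tridiagonal $n\times n$ matrix with $A^{(n)}_{j,j}=\nu_j$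 and $A^{(n)}_{j,j+1}=A^{(n)}_{j+1,j}=-\mu_j$, and $B^{(n)}$ is the antisymmetric tridiagonal $n\times n$ matrix with $B^{(n)}_{j,j}=0$, $B^{(n)}_{j,j+1}=-\mu_j\gamma_j$, $B^{(n)}_{j+1,j}=\mu_j\gamma_j$. Dynamical localization: writing $M^{(n)}_{j,k}(t)=\left(e^{-iM^{(n)}t}\right)_{j,k}$, the matrices $M^{(n)}$ are called dynamically localized (with constants $C,\eta$) if there exist $C>0$ and $\eta>0$ such that for any integers $j,k,n\ge1$ with $j,k\in[1,n]$, $$\mathbb{E}\left(\sup_{t\in\mathbb{R}}|M^{(n)}_{j,k}(t)|+\sup_{t\in\mathbb{R}}|M^{(n)}_{j,n+k}(t)|\right)\le Ce^{-\eta|j-k|}.$$ The constants $C,\eta$ are independent of $n$. *)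

theory Defs
  imports "HOL-Probability.Probability" "Jordan_Normal_Form.Matrix"
begin

text \<open>Operators on the n-fold tensor power of \<open>\<complex>\<^sup>2\<close> are complex matrices of size \<open>2 ^ n\<close>
  with respect to the product basis in lexicographic order, so that tensor products of operators
  are Kronecker products and site 1 is the leftmost factor. Sites are numbered from 1; matrix
  entries are numbered from 0.\<close>

definition kron :: "complex mat \<Rightarrow> complex mat \<Rightarrow> complex mat" where
  "kron A B = mat (dim_row A * dim_row B) (dim_col A * dim_col B)
     (\<lambda>(i, j). A $$ (i div dim_row B, j div dim_col B) * B $$ (i mod dim_row B, j mod dim_col B))"

text \<open>Matrices of a fixed size do not form a type, so the generic \<open>\<Sum>\<close> does not apply to them.\<close>

definition sum_mat :: "nat \<Rightarrow> ('i \<Rightarrow> complex mat) \<Rightarrow> 'i set \<Rightarrow> complex mat" where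
  "sum_mat d f I = mat d d (\<lambda>(a, b). \<Sum>i\<in>I. f i $$ (a, b))"

text \<open>Matrix exponential of a square matrix; convergence of the exponential series in the
  space of matrices is entrywise convergence.\<close>

definition mat_exp :: "complex mat \<Rightarrow> complex mat" where
  "mat_exp A = mat (dim_row A) (dim_row A) (\<lambda>(a, b). \<Sum>m. (A ^\<^sub>m m) $$ (a, b) / fact m)"

definition l2_norm :: "complex vec \<Rightarrow> real" where
  "l2_norm v = sqrt (\<Sum>i<dim_vec v. (cmod (vec_index v i))\<^sup>2)"

definition op_norm :: "complex mat \<Rightarrow> real" where
  "op_norm A = (SUP v \<in> {v \<in> carrier_vec (dim_col A). l2_norm v \<le> 1}. l2_norm (A *\<^sub>v v))"

definition commutator :: "complex mat \<Rightarrow> complex mat \<Rightarrow> complex mat" where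
  "commutator A B = A * B - B * A"

definition pauli_x :: "complex mat" where
  "pauli_x = mat_of_rows_list 2 [[0, 1], [1, 0]]"

definition pauli_y :: "complex mat" where
  "pauli_y = mat_of_rows_list 2 [[0, - \<i>], [\<i>, 0]]"

definition pauli_z :: "complex mat" where
  "pauli_z = mat_of_rows_list 2 [[1, 0], [0, - 1]]"

text \<open>\<open>embed n a b X\<close> is \<open>X\<close>, acting on the sites \<open>a, \<dots>, b\<close>, tensored with the identity on all
  other sites of \<open>1, \<dots>, n\<close>. It is meaningful for \<open>1 \<le> a \<le> b \<le> n\<close>.\<close>

definition embed :: "nat \<Rightarrow> nat \<Rightarrow> nat \<Rightarrow> complex mat \<Rightarrow> complex mat" where
  "embed n a b X = kron (kron (1\<^sub>m (2 ^ (a - 1))) X) (1\<^sub>m (2 ^ (n - b)))"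

definition local_algebra :: "nat \<Rightarrow> nat \<Rightarrow> nat \<Rightarrow> complex mat set" where
  "local_algebra n a b = embed n a b ` carrier_mat (2 ^ (b + 1 - a)) (2 ^ (b + 1 - a))"

definition xy_hamiltonian ::
    "(nat \<Rightarrow> real) \<Rightarrow> (nat \<Rightarrow> real) \<Rightarrow> (nat \<Rightarrow> real) \<Rightarrow> nat \<Rightarrow> complex mat" where
  "xy_hamiltonian \<mu> \<gamma> \<nu> n =
     sum_mat (2 ^ n)
       (\<lambda>j. complex_of_real (\<mu> j) \<cdot>\<^sub>m
          (complex_of_real (1 + \<gamma> j) \<cdot>\<^sub>m (embed n j j pauli_x * embed n (j + 1) (j + 1) pauli_x) +
           complex_of_real (1 - \<gamma> j) \<cdot>\<^sub>m (embed n j j pauli_y * embed n (j + 1) (j + 1) pauli_y)))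
       {1..<n}
   + sum_mat (2 ^ n) (\<lambda>j. complex_of_real (\<nu> j) \<cdot>\<^sub>m embed n j j pauli_z) {1..n}"

definition heisenberg :: "complex mat \<Rightarrow> real \<Rightarrow> complex mat \<Rightarrow> complex mat" where
  "heisenberg H t A =
     mat_exp ((\<i> * complex_of_real t) \<cdot>\<^sub>m H) * A * mat_exp ((- \<i> * complex_of_real t) \<cdot>\<^sub>m H)"

definition block_A :: "(nat \<Rightarrow> real) \<Rightarrow> (nat \<Rightarrow> real) \<Rightarrow> nat \<Rightarrow> real mat" where
  "block_A \<mu> \<nu> n = mat n n (\<lambda>(a, b).
     if a = b then \<nu> (a + 1)
     else if b = a + 1 then - \<mu> (a + 1)
     else if a = b + 1 then - \<mu> (b + 1)
     else 0)"

definition block_B :: "(nat \<Rightarrow> real) \<Rightarrow> (nat \<Rightarrow> real) \<Rightarrow> nat \<Rightarrow> real mat" where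
  "block_B \<mu> \<gamma> n = mat n n (\<lambda>(a, b).
     if b = a + 1 then - \<mu> (a + 1) * \<gamma> (a + 1)
     else if a = b + 1 then \<mu> (b + 1) * \<gamma> (b + 1)
     else 0)"

definition one_particle ::
    "(nat \<Rightarrow> real) \<Rightarrow> (nat \<Rightarrow> real) \<Rightarrow> (nat \<Rightarrow> real) \<Rightarrow> nat \<Rightarrow> real mat" where
  "one_particle \<mu> \<gamma> \<nu> n =
     four_block_mat (block_A \<mu> \<nu> n) (block_B \<mu> \<gamma> n) (- block_B \<mu> \<gamma> n) (- block_A \<mu> \<nu> n)"

text \<open>The entry \<open>(exp (- \<i> t M))\<^sub>j\<^sub>,\<^sub>k\<close>, with \<open>j\<close> and \<open>k\<close> numbered from 1.\<close>

definition propagator_entry :: "real mat \<Rightarrow> nat \<Rightarrow> nat \<Rightarrow> real \<Rightarrow> complex" where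
  "propagator_entry M j k t =
     mat_exp ((- \<i> * complex_of_real t) \<cdot>\<^sub>m map_mat complex_of_real M) $$ (j - 1, k - 1)"

text \<open>Expectations of nonnegative quantities are taken as \<open>[0, \<infinity>]\<close>-valued integrals, so that
  neither the suprema nor the integrals take default values.\<close>

definition dynamically_localized ::
    "'w measure \<Rightarrow> (nat \<Rightarrow> 'w \<Rightarrow> real mat) \<Rightarrow> real \<Rightarrow> real \<Rightarrow> bool" where
  "dynamically_localized P M C \<eta> \<longleftrightarrow> C > 0 \<and> \<eta> > 0 \<and>
     (\<forall>n j k. 1 \<le> j \<and> j \<le> n \<and> 1 \<le> k \<and> k \<le> n \<longrightarrow>
        (\<integral>\<^sup>+\<omega>. (SUP t::real. ennreal (cmod (propagator_entry (M n \<omega>) j k t)))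
             + (SUP t::real. ennreal (cmod (propagator_entry (M n \<omega>) j (n + k) t))) \<partial>P)
        \<le> ennreal (C * exp (- \<eta> * \<bar>real j - real k\<bar>)))"

definition commutator_bound ::
    "'w measure \<Rightarrow> (nat \<Rightarrow> 'w \<Rightarrow> complex mat) \<Rightarrow> real \<Rightarrow> real \<Rightarrow> bool" where
  "commutator_bound P H C \<eta> \<longleftrightarrow>
     (\<forall>j k n. 1 \<le> j \<and> j < k \<and> k \<le> n \<longrightarrow>
        (\<forall>A \<in> local_algebra n j j. \<forall>B \<in> local_algebra n k n.
           (\<integral>\<^sup>+\<omega>. (SUP t::real. ennreal (op_norm (commutator (heisenberg (H n \<omega>) t A) B))) \<partial>P)
           \<le> ennreal (C * op_norm A * op_norm B * exp (- \<eta> * \<bar>real k - real j\<bar>))))"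

end

theory Submission
  imports Defs
begin

text \<open>The Jordan-Wigner transform \<open>c\<^sub>j = \<sigma>\<^sup>z\<^sub>1 \<dots> \<sigma>\<^sup>z\<^sub>j\<^sub>-\<^sub>1 a\<^sub>j\<close>, where \<open>a\<^sub>j\<close> lowers the spin at site \<open>j\<close>, turns the
  chain into free fermions: \<open>[H, c\<^sub>j]\<close> is the linear combination of the \<open>c\<^sub>m\<close> and \<open>c\<^sub>m\<^sup>*\<close> given by the
  row \<open>j\<close> of \<open>- 2 M\<close>, hence \<open>\<tau>\<^sub>t(c\<^sub>j)\<close> is the one given by the row \<open>j\<close> of \<open>exp (- 2 i t M)\<close>.
  Since \<open>c\<^sub>m\<close> commutes with \<open>B\<close> for \<open>m < k\<close>, the norm of \<open>[\<tau>\<^sub>t(c\<^sub>j), B]\<close> is at most \<open>2 \<parallel>B\<parallel>\<close> times the sum of the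
  propagator entries from \<open>j\<close> to the sites in \<open>[k, n]\<close>. The Leibniz rule carries this over to
  \<open>\<sigma>\<^sup>z\<^sub>j = 2 c\<^sub>j\<^sup>* c\<^sub>j - 1\<close>, to the string \<open>\<sigma>\<^sup>z\<^sub>1 \<dots> \<sigma>\<^sup>z\<^sub>j\<^sub>-\<^sub>1\<close> and so to every operator at site \<open>j\<close>. Taking
  suprema and expectations leaves a double geometric sum, whence the square in the constant.\<close>

section \<open>Kronecker products and product operators\<close>

text \<open>The obstacle is that \<open>c\<^sub>m\<close> is not local: its string covers every site
  to the left of \<open>m\<close>. On the side of \<open>B\<close> this is harmless, because
  \<open>B\<close> occupies the right end of the chain and an operator supported on sites up to
  \<open>m < k\<close> never meets it. On the side of \<open>A\<close> the string has to be paid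
  for: freeing a ladder operator at \<open>j\<close> from it costs one evolved
  \<open>pauli_z\<close> for each \<open>l < j\<close>. Hence the estimate sums over sources
  \<open>l \<le> j\<close> as well as over targets \<open>m \<ge> k\<close>, and since
  \<open>l \<le> j < k \<le> m\<close> the decay factors split into two independent geometric
  series. The evolution of the ladder operators is found by algebra instead of a differential
  equation: a relation \<open>H X = X H + G X\<close>, with \<open>G\<close> mixing the members of
  the family \<open>X\<close>, is iterated to all powers of \<open>H\<close> and summed into the
  exponentials. The count of constants is 2 for a ladder operator, 4 for a product of two, 8 for
  \<open>pauli_z\<close>, and at most 16 for an operator at one site, each in units of the norm of
  \<open>B\<close> times a sum of propagator entries.\<close>

abbreviation adj :: "complex mat \<Rightarrow> complex mat" where
  "adj A \<equiv> map_mat cnj (transpose_mat A)"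

lemma adj_carrier: "A \<in> carrier_mat n m \<Longrightarrow> adj A \<in> carrier_mat m n"
  by auto

lemma adj_add:
  assumes "A \<in> carrier_mat n m" "B \<in> carrier_mat n m"
  shows "adj (A + B) = adj A + adj B"
  using assms by (intro eq_matI) auto

lemma adj_smult: "adj (c \<cdot>\<^sub>m A) = cnj c \<cdot>\<^sub>m adj A"
  by (intro eq_matI) auto

lemma adj_mult:
  assumes "A \<in> carrier_mat n m" "B \<in> carrier_mat m k"
  shows "adj (A * B) = adj B * adj A"
  using assms by (intro eq_matI) (auto simp: scalar_prod_def mult.commute)

text \<open>Splits the inner index of a product of Kronecker matrices into its two mixed-radix
  digits.\<close>

lemma sum_div_mod:
  fixes f :: "nat \<Rightarrow> 'a::comm_monoid_add"
  shows "(\<Sum>k = 0..<m * n. f k) = (\<Sum>i = 0..<m. \<Sum>j = 0..<n. f (i * n + j))"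
  by (simp add: sum.nat_group[symmetric] sum.atLeastLessThan_shift_0[of f] atLeast0LessThan)

lemma dim_kron [simp]:
  "dim_row (kron A B) = dim_row A * dim_row B"
  "dim_col (kron A B) = dim_col A * dim_col B"
  by (auto simp: kron_def)

lemma index_kron:
  assumes "i < dim_row A * dim_row B" "j < dim_col A * dim_col B"
  shows "kron A B $$ (i, j) =
    A $$ (i div dim_row B, j div dim_col B) * B $$ (i mod dim_row B, j mod dim_col B)"
  using assms by (simp add: kron_def)

lemma div_mod_lt:
  fixes i :: nat
  assumes "i < a * b"
  shows "i div b < a" "i mod b < b"
  using assms by (auto simp: less_mult_imp_div_less) (metis mod_less_divisor mult_0_right neq0_conv not_less0)

lemma kron_mult:
  assumes "A \<in> carrier_mat a b" "B \<in> carrier_mat b c" "X \<in> carrier_mat d e" "Y \<in> carrier_mat e f"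
  shows "kron A X * kron B Y = kron (A * B) (X * Y)"
proof (rule eq_matI)
  fix i j
  assume "i < dim_row (kron (A * B) (X * Y))" "j < dim_col (kron (A * B) (X * Y))"
  then have ij: "i < a * d" "j < c * f" using assms by auto
  note b = div_mod_lt[OF ij(1)] div_mod_lt[OF ij(2)]
  have lt: "k * e + l < b * e" if "k < b" "l < e" for k l
  proof -
    have "k * e + l < (k + 1) * e" using that by simp
    also have "\<dots> \<le> b * e" using that by (intro mult_right_mono) auto
    finally show ?thesis .
  qed
  have "(kron A X * kron B Y) $$ (i, j) = (\<Sum>k = 0..<b * e. kron A X $$ (i, k) * kron B Y $$ (k, j))"
    using assms ij by (simp add: scalar_prod_def)
  also have "\<dots> = (\<Sum>k = 0..<b. \<Sum>l = 0..<e. (A $$ (i div d, k) * B $$ (k, j div f)) * (X $$ (i mod d, l) * Y $$ (l, j mod f)))"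
    unfolding sum_div_mod using assms ij lt
    by (intro sum.cong) (auto simp: index_kron)
  also have "\<dots> = kron (A * B) (X * Y) $$ (i, j)"
    using assms ij b by (simp add: index_kron scalar_prod_def sum_product)
  finally show "(kron A X * kron B Y) $$ (i, j) = kron (A * B) (X * Y) $$ (i, j)" .
qed (use assms in auto)

text \<open>Both sides read the same three mixed-radix digits off an index; only the order in which
  they are split off differs.\<close>

lemma kron_assoc: "kron (kron A B) D = kron A (kron B D)"
proof (rule eq_matI)
  fix i j
  assume "i < dim_row (kron A (kron B D))" "j < dim_col (kron A (kron B D))"
  then have ij: "i < (dim_row A * dim_row B) * dim_row D" "j < (dim_col A * dim_col B) * dim_col D"
    by (auto simp: mult.assoc)
  show "kron (kron A B) D $$ (i, j) = kron A (kron B D) $$ (i, j)"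
    using ij div_mod_lt[OF ij(1)] div_mod_lt[OF ij(2)]
      div_mod_lt[of i "dim_row A" "dim_row B * dim_row D"]
      div_mod_lt[of j "dim_col A" "dim_col B * dim_col D"]
    by (simp add: index_kron mult.assoc div_mult2_eq mult.commute[of "dim_row B"] mult.commute[of "dim_col B"] mod_mult2_eq)
qed (auto simp: mult.assoc)

lemma kron_one: "kron (1\<^sub>m a) (1\<^sub>m b) = 1\<^sub>m (a * b)"
proof (rule eq_matI)
  fix i j assume "i < dim_row (1\<^sub>m (a * b))" "j < dim_col (1\<^sub>m (a * b))"
  then have ij: "i < a * b" "j < a * b" by auto
  have "(i div b = j div b \<and> i mod b = j mod b) = (i = j)"
    by (metis div_mult_mod_eq)
  then show "kron (1\<^sub>m a) (1\<^sub>m b) $$ (i, j) = 1\<^sub>m (a * b) $$ (i, j)"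
    using ij div_mod_lt[OF ij(1)] div_mod_lt[OF ij(2)] by (auto simp: index_kron)
qed auto

lemma kron_one_right [simp]: "kron A (1\<^sub>m 1) = A"
  by (rule eq_matI) (auto simp: index_kron)

lemma kron_one_left [simp]: "kron (1\<^sub>m 1) A = A"
  by (rule eq_matI) (auto simp: index_kron)

lemma kron_add_right:
  assumes "A \<in> carrier_mat a b" "X \<in> carrier_mat c d" "Y \<in> carrier_mat c d"
  shows "kron A (X + Y) = kron A X + kron A Y"
  using assms by (intro eq_matI) (auto simp: index_kron div_mod_lt distrib_left)

lemma kron_add_left:
  assumes "A \<in> carrier_mat c d" "B \<in> carrier_mat a b" "X \<in> carrier_mat a b"
  shows "kron (B + X) A = kron B A + kron X A"
  using assms by (intro eq_matI) (auto simp: index_kron div_mod_lt distrib_right)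

lemma kron_smult_right: "kron A (c \<cdot>\<^sub>m X) = c \<cdot>\<^sub>m kron A X"
  by (intro eq_matI) (auto simp: index_kron div_mod_lt)

lemma kron_smult_left: "kron (c \<cdot>\<^sub>m A) X = c \<cdot>\<^sub>m kron A X"
  by (intro eq_matI) (auto simp: index_kron div_mod_lt)

lemma adj_kron: "adj (kron A B) = kron (adj A) (adj B)"
  by (intro eq_matI) (auto simp: index_kron div_mod_lt)

text \<open>The pure tensor with factors \<open>f 1\<close>, ..., \<open>f n\<close>. Site
  operators, bonds, strings and Jordan-Wigner operators all have this form, so that their products
  reduce to products of 2 x 2 matrices site by site.\<close>

primrec site_prod :: "nat \<Rightarrow> (nat \<Rightarrow> complex mat) \<Rightarrow> complex mat" where
  "site_prod 0 f = 1\<^sub>m 1"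
| "site_prod (Suc n) f = kron (site_prod n f) (f (Suc n))"

lemma site_prod_carrier:
  "(\<And>i. f i \<in> carrier_mat 2 2) \<Longrightarrow> site_prod n f \<in> carrier_mat (2 ^ n) (2 ^ n)"
  by (induction n) (auto simp: mult.commute carrier_matD[where nr=2 and nc=2])

lemma site_prod_cong:
  "(\<And>i. 1 \<le> i \<Longrightarrow> i \<le> n \<Longrightarrow> f i = g i) \<Longrightarrow> site_prod n f = site_prod n g"
  by (induction n) auto

lemma site_prod_mult:
  assumes "\<And>i. f i \<in> carrier_mat 2 2" "\<And>i. g i \<in> carrier_mat 2 2"
  shows "site_prod n f * site_prod n g = site_prod n (\<lambda>i. f i * g i)"
proof (induction n)
  case (Suc n)
  show ?case
    using kron_mult[OF site_prod_carrier[of f n] site_prod_carrier[of g n] assms(1)[of "Suc n"] assms(2)[of "Suc n"]]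
      assms Suc by simp
qed auto

lemma adj_site_prod: "adj (site_prod n f) = site_prod n (\<lambda>i. adj (f i))"
proof (induction n)
  case 0 show ?case by (auto intro!: eq_matI)
next
  case (Suc n) then show ?case by (simp add: adj_kron)
qed

text \<open>Multilinearity in slot \<open>j\<close>. Writing the slot as a function update is what
  lifts a relation between 2 x 2 matrices at one site to the whole chain.\<close>

lemma site_prod_add:
  assumes "\<And>i. f i \<in> carrier_mat 2 2" "X \<in> carrier_mat 2 2" "Y \<in> carrier_mat 2 2" "1 \<le> j" "j \<le> n"
  shows "site_prod n (f(j := X + Y)) = site_prod n (f(j := X)) + site_prod n (f(j := Y))"
  using assms(5)
proof (induction n)
  case 0 then show ?case using assms(4) by simp
next
  case (Suc n)
  have c: "site_prod n (\<lambda>i. if i = j then Z else f i) \<in> carrier_mat (2 ^ n) (2 ^ n)" if "Z \<in> carrier_mat 2 2" for Z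
    using assms(1) that by (intro site_prod_carrier) auto
  show ?case
  proof (cases "j = Suc n")
    case True
    then have "site_prod n (\<lambda>i. if i = Suc n then Z else f i) = site_prod n f" for Z
      by (intro site_prod_cong) auto
    then show ?thesis using True assms
      by (simp add: kron_add_right[OF site_prod_carrier])
  next
    case False
    then show ?thesis using Suc kron_add_left[OF assms(1) c c] assms by simp
  qed
qed

lemma site_prod_smult:
  assumes "1 \<le> j" "j \<le> n"
  shows "site_prod n (f(j := c \<cdot>\<^sub>m X)) = c \<cdot>\<^sub>m site_prod n (f(j := X))"
  using assms(2)
proof (induction n)
  case 0 then show ?case using assms by simp
next
  case (Suc n)
  show ?case
  proof (cases "j = Suc n")
    case True
    then have "site_prod n (\<lambda>i. if i = Suc n then Z else f i) = site_prod n f" for Z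
      by (intro site_prod_cong) auto
    then show ?thesis using True by (simp add: kron_smult_right)
  next
    case False
    then show ?thesis using Suc by (simp add: kron_smult_left)
  qed
qed

lemma site_prod_split:
  assumes "\<And>i. k < i \<Longrightarrow> i \<le> n \<Longrightarrow> f i = 1\<^sub>m 2" "k \<le> n"
  shows "site_prod n f = kron (site_prod k f) (1\<^sub>m (2 ^ (n - k)))"
  using assms(2,1)
proof (induction n rule: dec_induct)
  case base show ?case using kron_one_right by simp
next
  case (step n)
  then have "Suc n - k = Suc (n - k)" by simp
  with step show ?case
    by (simp add: kron_assoc kron_one mult.commute)
qed

lemma site_prod_one: "site_prod n (\<lambda>_. 1\<^sub>m 2) = 1\<^sub>m (2 ^ n)"
  using site_prod_split[of 0 n "\<lambda>_. 1\<^sub>m 2"] kron_one_left by simp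

lemma embed_eq_site_prod:
  assumes "1 \<le> j" "j \<le> n"
  shows "embed n j j X = site_prod n (\<lambda>i. if i = j then X else 1\<^sub>m 2)"
proof -
  obtain m where m: "j = Suc m" using assms by (cases j) auto
  have "site_prod n (\<lambda>i. if i = j then X else 1\<^sub>m 2) =
    kron (site_prod j (\<lambda>i. if i = j then X else 1\<^sub>m 2)) (1\<^sub>m (2 ^ (n - j)))"
    by (rule site_prod_split) (use assms in auto)
  also have "site_prod m (\<lambda>i. if i = j then X else 1\<^sub>m 2) = site_prod m (\<lambda>i. 1\<^sub>m 2)"
    by (rule site_prod_cong) (use m in auto)
  then have "site_prod j (\<lambda>i. if i = j then X else 1\<^sub>m 2) = kron (1\<^sub>m (2 ^ (j - 1))) X"
    using m by (simp add: site_prod_one)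
  finally show ?thesis by (simp add: embed_def)
qed

text \<open>Cut between the sites \<open>k - 1\<close> and \<open>k\<close>: the product is the
  identity on the right part and \<open>B\<close> is the identity on the left part, so both orders
  multiply to the same Kronecker product.\<close>

lemma site_prod_commute_local_algebra:
  assumes "\<And>i. f i \<in> carrier_mat 2 2" "\<And>i. k \<le> i \<Longrightarrow> f i = 1\<^sub>m 2" "1 \<le> k" "k \<le> n"
    and B: "B \<in> local_algebra n k n"
  shows "site_prod n f * B = B * site_prod n f"
proof -
  obtain Y where Y: "Y \<in> carrier_mat (2 ^ (n + 1 - k)) (2 ^ (n + 1 - k))" and "B = embed n k n Y"
    using B by (auto simp: local_algebra_def)
  then have B: "B = kron (1\<^sub>m (2 ^ (k - 1))) Y"
    using kron_one_right by (simp add: embed_def)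
  \<comment> \<open>The cut lies after site \<open>k - 1\<close>, and the right part has
    \<open>n + 1 - k\<close> sites, the size used in \<open>local_algebra\<close>.\<close>
  have n: "n - (k - 1) = n + 1 - k" using assms by simp
  have f: "site_prod n f = kron (site_prod (k - 1) f) (1\<^sub>m (2 ^ (n + 1 - k)))"
    unfolding n[symmetric] using assms by (intro site_prod_split) auto
  have c: "site_prod (k - 1) f \<in> carrier_mat (2 ^ (k - 1)) (2 ^ (k - 1))"
    using assms by (intro site_prod_carrier)
  show ?thesis unfolding B f
    using kron_mult[OF c one_carrier_mat one_carrier_mat Y] kron_mult[OF one_carrier_mat c Y one_carrier_mat] c Y
    by simp
qed

lemma local_algebra_carrier:
  assumes "B \<in> local_algebra n k n" "1 \<le> k" "k \<le> n"
  shows "B \<in> carrier_mat (2 ^ n) (2 ^ n)"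
proof -
  have "(2::nat) ^ (k - 1) * 2 ^ (n + 1 - k) = 2 ^ n"
    using assms by (simp flip: power_add)
  then show ?thesis using assms by (auto simp: local_algebra_def embed_def)
qed

section \<open>The operator norm\<close>

lemma l2_norm_eq_L2_set: "l2_norm v = L2_set (\<lambda>i. cmod (v $ i)) {..<dim_vec v}"
  by (simp add: l2_norm_def L2_set_def)

lemma l2_norm_nonneg [simp]: "0 \<le> l2_norm v"
  by (simp add: l2_norm_def sum_nonneg)

lemma l2_norm_zero [simp]: "l2_norm (0\<^sub>v n) = 0"
  by (simp add: l2_norm_def)

lemma l2_norm_triangle:
  assumes "v \<in> carrier_vec n" "w \<in> carrier_vec n"
  shows "l2_norm (v + w) \<le> l2_norm v + l2_norm w"
proof -
  have "l2_norm (v + w) \<le> L2_set (\<lambda>i. cmod (v $ i) + cmod (w $ i)) {..<n}"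
    unfolding l2_norm_eq_L2_set using assms by (auto intro!: L2_set_mono norm_triangle_ineq)
  also have "\<dots> \<le> l2_norm v + l2_norm w"
    using assms L2_set_triangle_ineq[of "\<lambda>i. cmod (v $ i)" "\<lambda>i. cmod (w $ i)" "{..<n}"]
    by (auto simp: l2_norm_eq_L2_set)
  finally show ?thesis .
qed

lemma l2_norm_smult: "l2_norm (c \<cdot>\<^sub>v v) = cmod c * l2_norm v"
  unfolding l2_norm_eq_L2_set by (auto simp: norm_mult L2_set_right_distrib intro!: L2_set_cong)

lemma l2_norm_eq_0: "l2_norm v = 0 \<longleftrightarrow> v = 0\<^sub>v (dim_vec v)"
  by (auto simp: l2_norm_def sum_nonneg_eq_0_iff sum_nonneg) (metis index_zero_vec(1))

lemma cmod_index_le_l2_norm: "i < dim_vec v \<Longrightarrow> cmod (v $ i) \<le> l2_norm v"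
  unfolding l2_norm_eq_L2_set by (rule member_le_L2_set) auto

lemma l2_norm_le_sum: "l2_norm v \<le> (\<Sum>i<dim_vec v. cmod (v $ i))"
  unfolding l2_norm_eq_L2_set by (rule L2_set_le_sum) auto

text \<open>The real supremum in \<open>op_norm\<close> is meaningful only over a bounded set. On
  the unit ball every coordinate of \<open>v\<close> has modulus at most 1, so the sum of the moduli
  of all entries is a bound.\<close>

lemma op_norm_bdd:
  "bdd_above ((\<lambda>v. l2_norm (A *\<^sub>v v)) ` {v \<in> carrier_vec (dim_col A). l2_norm v \<le> 1})"
proof (rule bdd_aboveI2)
  fix v assume v: "v \<in> {v \<in> carrier_vec (dim_col A). l2_norm v \<le> 1}"
  have "cmod ((A *\<^sub>v v) $ i) \<le> (\<Sum>j = 0..<dim_col A. cmod (A $$ (i, j)))" if i: "i < dim_row A" for i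
  proof -
    have "cmod ((A *\<^sub>v v) $ i) \<le> (\<Sum>j = 0..<dim_col A. cmod (A $$ (i, j)) * cmod (v $ j))"
      using v i by (auto simp: scalar_prod_def norm_mult intro!: order_trans[OF norm_sum])
    also have "\<dots> \<le> (\<Sum>j = 0..<dim_col A. cmod (A $$ (i, j)) * 1)"
      using v by (intro sum_mono mult_left_mono order_trans[OF cmod_index_le_l2_norm[of _ v]]) auto
    finally show ?thesis by simp
  qed
  then show "l2_norm (A *\<^sub>v v) \<le> (\<Sum>i<dim_row A. \<Sum>j = 0..<dim_col A. cmod (A $$ (i, j)))"
    by (intro order_trans[OF l2_norm_le_sum]) (auto intro!: sum_mono)
qed

lemma op_norm_leI:
  assumes "\<And>v. v \<in> carrier_vec (dim_col A) \<Longrightarrow> l2_norm v \<le> 1 \<Longrightarrow> l2_norm (A *\<^sub>v v) \<le> K"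
  shows "op_norm A \<le> K"
  unfolding op_norm_def
proof (rule cSUP_least)
  have "0\<^sub>v (dim_col A) \<in> {v \<in> carrier_vec (dim_col A). l2_norm v \<le> 1}" by simp
  then show "{v \<in> carrier_vec (dim_col A). l2_norm v \<le> 1} \<noteq> {}" by blast
qed (use assms in auto)

lemma op_norm_upper1:
  "v \<in> carrier_vec (dim_col A) \<Longrightarrow> l2_norm v \<le> 1 \<Longrightarrow> l2_norm (A *\<^sub>v v) \<le> op_norm A"
  unfolding op_norm_def by (rule cSUP_upper[OF _ op_norm_bdd]) auto

lemma op_norm_nonneg [simp]: "0 \<le> op_norm A"
  by (rule order_trans[OF l2_norm_nonneg op_norm_upper1[of "0\<^sub>v (dim_col A)" A]]) auto

lemma l2_norm_mult_mat_vec_le: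
  assumes "v \<in> carrier_vec (dim_col A)"
  shows "l2_norm (A *\<^sub>v v) \<le> op_norm A * l2_norm v"
proof (cases "l2_norm v = 0")
  case True
  then have "v = 0\<^sub>v (dim_col A)" using assms by (simp add: l2_norm_eq_0)
  then have "A *\<^sub>v v = 0\<^sub>v (dim_row A)" by (intro eq_vecI) auto
  then show ?thesis by simp
next
  case False
  then have pos: "0 < l2_norm v" using l2_norm_nonneg[of v] by linarith
  let ?c = "complex_of_real (inverse (l2_norm v))"
  have "l2_norm (?c \<cdot>\<^sub>v v) \<le> 1"
    using pos by (simp add: l2_norm_smult norm_inverse)
  then have "l2_norm (A *\<^sub>v (?c \<cdot>\<^sub>v v)) \<le> op_norm A"
    using assms by (intro op_norm_upper1) auto
  moreover have "A *\<^sub>v (?c \<cdot>\<^sub>v v) = ?c \<cdot>\<^sub>v (A *\<^sub>v v)"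
    using assms by (intro mult_mat_vec[of _ "dim_row A"]) auto
  ultimately have "inverse (l2_norm v) * l2_norm (A *\<^sub>v v) \<le> op_norm A"
    using pos by (simp add: l2_norm_smult norm_inverse)
  then show ?thesis using pos by (simp add: field_simps)
qed

lemma op_norm_add:
  assumes "A \<in> carrier_mat n m" "B \<in> carrier_mat n m"
  shows "op_norm (A + B) \<le> op_norm A + op_norm B"
proof (rule op_norm_leI)
  fix v :: "complex vec" assume v: "v \<in> carrier_vec (dim_col (A + B))" "l2_norm v \<le> 1"
  then have "(A + B) *\<^sub>v v = A *\<^sub>v v + B *\<^sub>v v"
    using assms by (intro add_mult_distrib_mat_vec) auto
  moreover have "l2_norm (A *\<^sub>v v + B *\<^sub>v v) \<le> l2_norm (A *\<^sub>v v) + l2_norm (B *\<^sub>v v)"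
    using assms by (intro l2_norm_triangle[of _ n] carrier_vecI) auto
  moreover have "l2_norm (A *\<^sub>v v) \<le> op_norm A" "l2_norm (B *\<^sub>v v) \<le> op_norm B"
    using assms v by (auto intro: op_norm_upper1)
  ultimately show "l2_norm ((A + B) *\<^sub>v v) \<le> op_norm A + op_norm B" by simp
qed

lemma op_norm_smult: "op_norm (c \<cdot>\<^sub>m A) \<le> cmod c * op_norm A"
proof (rule op_norm_leI)
  fix v :: "complex vec" assume v: "v \<in> carrier_vec (dim_col (c \<cdot>\<^sub>m A))" "l2_norm v \<le> 1"
  then have "(c \<cdot>\<^sub>m A) *\<^sub>v v = c \<cdot>\<^sub>v (A *\<^sub>v v)"
    by (intro eq_vecI) (auto simp: scalar_prod_def sum_distrib_left mult.assoc)
  moreover have "l2_norm (A *\<^sub>v v) \<le> op_norm A"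
    using v by (auto intro: op_norm_upper1)
  ultimately show "l2_norm ((c \<cdot>\<^sub>m A) *\<^sub>v v) \<le> cmod c * op_norm A"
    by (simp add: l2_norm_smult mult_left_mono)
qed

lemma op_norm_diff:
  assumes "A \<in> carrier_mat n m" "B \<in> carrier_mat n m"
  shows "op_norm (A - B) \<le> op_norm A + op_norm B"
proof -
  have "A - B = A + (-1) \<cdot>\<^sub>m B" using assms by (intro eq_matI) auto
  then show ?thesis
    using op_norm_add[of A n m "(-1) \<cdot>\<^sub>m B"] op_norm_smult[of "-1" B] assms by auto
qed

lemma op_norm_mult:
  assumes "A \<in> carrier_mat n m" "B \<in> carrier_mat m k"
  shows "op_norm (A * B) \<le> op_norm A * op_norm B"
proof (rule op_norm_leI)
  fix v :: "complex vec" assume v: "v \<in> carrier_vec (dim_col (A * B))" "l2_norm v \<le> 1"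
  then have "(A * B) *\<^sub>v v = A *\<^sub>v (B *\<^sub>v v)"
    using assms by (intro assoc_mult_mat_vec) auto
  moreover have "l2_norm (A *\<^sub>v (B *\<^sub>v v)) \<le> op_norm A * l2_norm (B *\<^sub>v v)"
    using assms by (intro l2_norm_mult_mat_vec_le carrier_vecI) auto
  moreover have "op_norm A * l2_norm (B *\<^sub>v v) \<le> op_norm A * op_norm B"
    using assms v by (intro mult_left_mono op_norm_upper1) auto
  ultimately show "l2_norm ((A * B) *\<^sub>v v) \<le> op_norm A * op_norm B" by simp
qed

text \<open>The norm is tested on a unit vector, whose image is a column of
  \<open>A\<close>.\<close>

lemma cmod_index_le_op_norm:
  assumes "i < dim_row A" "j < dim_col A"
  shows "cmod (A $$ (i, j)) \<le> op_norm A"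
proof -
  have "l2_norm (unit_vec (dim_col A) j :: complex vec) = 1"
    using assms by (simp add: l2_norm_def if_distrib[of cmod] if_distrib[of "\<lambda>x. x\<^sup>2"] cong: if_cong)
  then have "l2_norm (A *\<^sub>v unit_vec (dim_col A) j) \<le> op_norm A"
    by (intro op_norm_upper1) auto
  moreover have "A *\<^sub>v unit_vec (dim_col A) j = col A j"
    using assms by (intro eq_vecI) (auto simp: row_def)
  ultimately show ?thesis
    using cmod_index_le_l2_norm[of i "col A j"] assms by simp
qed

text \<open>Expanding \<open>\<parallel>X v\<parallel>\<^sup>2 + \<parallel>Y v\<parallel>\<^sup>2 = \<langle>v, (X\<^sup>* X + Y\<^sup>* Y) v\<rangle> = \<parallel>v\<parallel>\<^sup>2\<close>.\<close>

lemma op_norm_le_1: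
  assumes X: "X \<in> carrier_mat d d" and Y: "Y \<in> carrier_mat d d"
    and one: "adj X * X + adj Y * Y = 1\<^sub>m d"
  shows "op_norm X \<le> 1"
proof (rule op_norm_leI)
  fix v :: "complex vec" assume v: "v \<in> carrier_vec (dim_col X)" "l2_norm v \<le> 1"
  have sq: "complex_of_real ((l2_norm w)\<^sup>2) = (\<Sum>i<d. cnj (w $ i) * w $ i)" if "w \<in> carrier_vec d" for w
    using that by (simp add: l2_norm_def sum_nonneg complex_norm_square mult.commute del: of_real_power)
  have gram: "complex_of_real ((l2_norm (Z *\<^sub>v v))\<^sup>2) =
      (\<Sum>k<d. \<Sum>l<d. cnj (v $ k) * v $ l * (adj Z * Z) $$ (k, l))" if Z: "Z \<in> carrier_mat d d" for Z
  proof -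
    have "complex_of_real ((l2_norm (Z *\<^sub>v v))\<^sup>2) =
      (\<Sum>i<d. (\<Sum>k<d. cnj (Z $$ (i, k) * v $ k)) * (\<Sum>l<d. Z $$ (i, l) * v $ l))"
      using v X Z by (subst sq) (auto simp: scalar_prod_def atLeast0LessThan)
    also have "\<dots> = (\<Sum>i<d. \<Sum>k<d. \<Sum>l<d. cnj (v $ k) * v $ l * (cnj (Z $$ (i, k)) * Z $$ (i, l)))"
      unfolding sum_product by (intro sum.cong refl) (simp add: mult_ac)
    also have "\<dots> = (\<Sum>k<d. \<Sum>i<d. \<Sum>l<d. cnj (v $ k) * v $ l * (cnj (Z $$ (i, k)) * Z $$ (i, l)))"
      by (rule sum.swap)
    also have "\<dots> = (\<Sum>k<d. \<Sum>l<d. \<Sum>i<d. cnj (v $ k) * v $ l * (cnj (Z $$ (i, k)) * Z $$ (i, l)))"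
      by (intro sum.cong refl sum.swap)
    also have "\<dots> = (\<Sum>k<d. \<Sum>l<d. cnj (v $ k) * v $ l * (adj Z * Z) $$ (k, l))"
      using Z by (intro sum.cong refl) (auto simp: scalar_prod_def atLeast0LessThan sum_distrib_left)
    finally show ?thesis .
  qed
  have "complex_of_real ((l2_norm (X *\<^sub>v v))\<^sup>2 + (l2_norm (Y *\<^sub>v v))\<^sup>2) =
      (\<Sum>k<d. \<Sum>l<d. cnj (v $ k) * v $ l * (adj X * X + adj Y * Y) $$ (k, l))"
    unfolding of_real_add gram[OF X] gram[OF Y] using X Y
    by (simp add: sum.distrib[symmetric] distrib_left)
  also have "\<dots> = (\<Sum>k<d. cnj (v $ k) * v $ k)"
    unfolding one by (intro sum.cong refl) (auto simp: if_distrib[of "\<lambda>x. _ * x"] cong: if_cong)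
  also have "\<dots> = complex_of_real ((l2_norm v)\<^sup>2)"
    using sq v X by auto
  finally have "(l2_norm (X *\<^sub>v v))\<^sup>2 + (l2_norm (Y *\<^sub>v v))\<^sup>2 = (l2_norm v)\<^sup>2"
    using of_real_eq_iff by blast
  then have "(l2_norm (X *\<^sub>v v))\<^sup>2 \<le> (l2_norm v)\<^sup>2"
    by (metis le_add_same_cancel1 zero_le_power2)
  then show "l2_norm (X *\<^sub>v v) \<le> 1"
    using v by (meson l2_norm_nonneg order_trans power2_le_imp_le)
qed

lemma op_norm_unitary:
  assumes "X \<in> carrier_mat d d" "adj X * X = 1\<^sub>m d"
  shows "op_norm X \<le> 1"
proof (rule op_norm_le_1[OF assms(1) zero_carrier_mat])
  have "adj (0\<^sub>m d d) * 0\<^sub>m d d = (0\<^sub>m d d :: complex mat)"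
    by (intro eq_matI) auto
  then show "adj X * X + adj (0\<^sub>m d d) * 0\<^sub>m d d = 1\<^sub>m d"
    using assms by simp
qed

section \<open>Commutators and their norms\<close>

lemma commutator_carrier:
  "X \<in> carrier_mat d d \<Longrightarrow> B \<in> carrier_mat d d \<Longrightarrow> commutator X B \<in> carrier_mat d d"
  by (auto simp: commutator_def)

lemma commutator_add:
  assumes "X \<in> carrier_mat d d" "Y \<in> carrier_mat d d" "B \<in> carrier_mat d d"
  shows "commutator (X + Y) B = commutator X B + commutator Y B"
  using assms unfolding commutator_def
  by (simp add: add_mult_distrib_mat[OF assms(1,2,3)] mult_add_distrib_mat[OF assms(3,1,2)])
    (rule eq_matI, auto)

lemma commutator_smult:
  assumes "X \<in> carrier_mat d d" "B \<in> carrier_mat d d"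
  shows "commutator (c \<cdot>\<^sub>m X) B = c \<cdot>\<^sub>m commutator X B"
  using assms unfolding commutator_def
  by (simp add: mult_smult_assoc_mat[OF assms] mult_smult_distrib[OF assms(2,1)])
    (rule eq_matI, auto simp: right_diff_distrib)

lemma commutator_mult:
  assumes "X \<in> carrier_mat d d" "Y \<in> carrier_mat d d" "B \<in> carrier_mat d d"
  shows "commutator (X * Y) B = X * commutator Y B + commutator X B * Y"
proof -
  note c = assms mult_carrier_mat[OF assms(1) assms(2)] mult_carrier_mat[OF assms(2) assms(3)]
    mult_carrier_mat[OF assms(3) assms(2)] mult_carrier_mat[OF assms(3) assms(1)] mult_carrier_mat[OF assms(1) assms(3)]
  have "X * commutator Y B + commutator X B * Y = (X * (Y * B) - X * (B * Y)) + (X * B * Y - B * X * Y)"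
    unfolding commutator_def
    by (simp only: mult_minus_distrib_mat[OF c(1,5,6)] minus_mult_distrib_mat[OF c(8,7,2)])
  also have "\<dots> = X * Y * B - B * (X * Y)"
    using c by (simp add: assoc_mult_mat[of _ d d _ d _ d]) (rule eq_matI, auto)
  finally show ?thesis by (simp add: commutator_def)
qed

lemma op_norm_commutator_le:
  assumes "X \<in> carrier_mat d d" "B \<in> carrier_mat d d"
  shows "op_norm (commutator X B) \<le> 2 * op_norm X * op_norm B"
proof -
  have "op_norm (commutator X B) \<le> op_norm (X * B) + op_norm (B * X)"
    unfolding commutator_def using assms by (intro op_norm_diff[of _ d d]) auto
  also have "\<dots> \<le> 2 * op_norm X * op_norm B"
    using op_norm_mult[OF assms] op_norm_mult[OF assms(2,1)] by (simp add: mult.commute)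
  finally show ?thesis .
qed

lemma op_norm_commutator_add:
  assumes "X \<in> carrier_mat d d" "Y \<in> carrier_mat d d" "B \<in> carrier_mat d d"
  shows "op_norm (commutator (X + Y) B) \<le> op_norm (commutator X B) + op_norm (commutator Y B)"
  unfolding commutator_add[OF assms]
  by (intro op_norm_add[of _ d d] commutator_carrier assms)

lemma op_norm_commutator_smult:
  assumes "X \<in> carrier_mat d d" "B \<in> carrier_mat d d"
  shows "op_norm (commutator (c \<cdot>\<^sub>m X) B) \<le> cmod c * op_norm (commutator X B)"
  unfolding commutator_smult[OF assms] by (rule op_norm_smult)

text \<open>For contractions the Leibniz rule costs no factor: the norms of the commutators simply
  add. A product of many contractions, such as a string, is therefore charged only once for each of
  its factors.\<close>

lemma op_norm_commutator_mult:
  assumes "X \<in> carrier_mat d d" "Y \<in> carrier_mat d d" "B \<in> carrier_mat d d"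
    and "op_norm X \<le> 1" "op_norm Y \<le> 1"
  shows "op_norm (commutator (X * Y) B) \<le> op_norm (commutator X B) + op_norm (commutator Y B)"
proof -
  note c = commutator_carrier[OF assms(1,3)] commutator_carrier[OF assms(2,3)]
  have "op_norm (commutator (X * Y) B) \<le> op_norm (X * commutator Y B) + op_norm (commutator X B * Y)"
    unfolding commutator_mult[OF assms(1-3)] using assms c by (intro op_norm_add[of _ d d]) auto
  also have "\<dots> \<le> op_norm X * op_norm (commutator Y B) + op_norm (commutator X B) * op_norm Y"
    by (intro add_mono op_norm_mult[of _ d d _ d] assms c)
  also have "\<dots> \<le> 1 * op_norm (commutator Y B) + op_norm (commutator X B) * 1"
    by (intro add_mono mult_mono assms) auto
  finally show ?thesis by simp
qed

section \<open>Matrix exponentials and Heisenberg evolution\<close>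

lemma mat_mult_index:
  assumes "A \<in> carrier_mat n m" "B \<in> carrier_mat m k" "i < n" "j < k"
  shows "(A * B) $$ (i, j) = (\<Sum>l<m. A $$ (i, l) * B $$ (l, j))"
  using assms by (auto simp: scalar_prod_def atLeast0LessThan)

lemma sum_mat_carrier [simp]: "sum_mat d f I \<in> carrier_mat d d"
  by (simp add: sum_mat_def)

lemma index_sum_mat [simp]:
  "a < d \<Longrightarrow> b < d \<Longrightarrow> sum_mat d f I $$ (a, b) = (\<Sum>i\<in>I. f i $$ (a, b))"
  by (simp add: sum_mat_def)

lemma pow_mat_carrier: "A \<in> carrier_mat d d \<Longrightarrow> A ^\<^sub>m m \<in> carrier_mat d d"
  by (induction m) auto

lemma pow_mat_Suc_left: "A \<in> carrier_mat d d \<Longrightarrow> A ^\<^sub>m Suc m = A * A ^\<^sub>m m"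
proof (induction m)
  case (Suc m)
  then show ?case
    using assoc_mult_mat[OF Suc.prems pow_mat_carrier[OF Suc.prems] Suc.prems, of m] by simp
qed auto

lemma mat_exp_carrier: "A \<in> carrier_mat d d \<Longrightarrow> mat_exp A \<in> carrier_mat d d"
  by (auto simp: mat_exp_def)

text \<open>In the step the entry \<open>A $$ (k, j)\<close> is enlarged to the sum over row
  \<open>k\<close>; adding over \<open>k\<close> produces one more factor, the sum over all entries.
  This crude bound gives the absolute convergence that the Cauchy product below requires.\<close>

lemma cmod_pow_mat_le:
  fixes A :: "complex mat"
  assumes A: "A \<in> carrier_mat d d" and "i < d" "j < d"
  shows "cmod ((A ^\<^sub>m m) $$ (i, j)) \<le> (\<Sum>k<d. \<Sum>l<d. cmod (A $$ (k, l))) ^ m"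
  using assms(2,3)
proof (induction m arbitrary: i j)
  case 0 then show ?case using A by auto
next
  case (Suc m)
  let ?K = "\<Sum>k<d. \<Sum>l<d. cmod (A $$ (k, l))"
  have "cmod ((A ^\<^sub>m Suc m) $$ (i, j)) \<le> (\<Sum>k<d. cmod ((A ^\<^sub>m m) $$ (i, k)) * cmod (A $$ (k, j)))"
    using mat_mult_index[OF pow_mat_carrier[OF A] A Suc.prems, of m] by (simp add: norm_mult sum_norm_le)
  also have "\<dots> \<le> (\<Sum>k<d. ?K ^ m * (\<Sum>l<d. cmod (A $$ (k, l))))"
    using Suc by (intro sum_mono mult_mono member_le_sum zero_le_power sum_nonneg) auto
  also have "\<dots> = ?K ^ Suc m"
    by (simp add: sum_distrib_left[symmetric])
  finally show ?case .
qed

lemma summable_mat_exp: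
  fixes A :: "complex mat"
  assumes "A \<in> carrier_mat d d" "i < d" "j < d"
  shows "summable (\<lambda>m. cmod ((A ^\<^sub>m m) $$ (i, j) / fact m))"
proof (rule summable_comparison_test')
  let ?K = "\<Sum>k<d. \<Sum>l<d. cmod (A $$ (k, l))"
  show "summable (\<lambda>m. inverse (fact m) * ?K ^ m)" by (rule summable_exp)
  show "norm (cmod ((A ^\<^sub>m m) $$ (i, j) / fact m)) \<le> inverse (fact m) * ?K ^ m" if "0 \<le> m" for m
    using cmod_pow_mat_le[OF assms, of m] by (simp add: norm_divide field_simps)
qed

lemma mat_exp_sums:
  fixes A :: "complex mat"
  assumes "A \<in> carrier_mat d d" "i < d" "j < d"
  shows "(\<lambda>m. (A ^\<^sub>m m) $$ (i, j) / fact m) sums mat_exp A $$ (i, j)"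
  using summable_sums[OF summable_norm_cancel[OF summable_mat_exp[OF assms]]] assms
  by (auto simp: mat_exp_def)

lemma adj_pow_mat: "A \<in> carrier_mat d d \<Longrightarrow> adj (A ^\<^sub>m m) = adj A ^\<^sub>m m"
proof (induction m)
  case 0 then show ?case by (auto intro!: eq_matI)
next
  case (Suc m)
  then show ?case
    using pow_mat_Suc_left[OF adj_carrier[OF Suc.prems], of m] adj_mult[OF pow_mat_carrier[OF Suc.prems] Suc.prems, of m]
    by simp
qed

lemma adj_mat_exp:
  assumes A: "A \<in> carrier_mat d d"
  shows "adj (mat_exp A) = mat_exp (adj A)"
proof (rule eq_matI)
  fix i j assume "i < dim_row (mat_exp (adj A))" "j < dim_col (mat_exp (adj A))"
  then have ij: "i < d" "j < d" using A by (auto simp: mat_exp_def)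
  have "(\<lambda>m. cnj ((A ^\<^sub>m m) $$ (j, i) / fact m)) sums cnj (mat_exp A $$ (j, i))"
    using mat_exp_sums[OF A ij(2,1)] by (simp only: sums_cnj)
  moreover have "cnj ((A ^\<^sub>m m) $$ (j, i) / fact m) = (adj A ^\<^sub>m m) $$ (i, j) / fact m" for m
    unfolding adj_pow_mat[OF A, symmetric] using ij carrier_matD[OF pow_mat_carrier[OF A]] by simp
  ultimately have "cnj (mat_exp A $$ (j, i)) = mat_exp (adj A) $$ (i, j)"
    using mat_exp_sums[OF adj_carrier[OF A] ij] sums_unique2 by (metis (no_types, lifting) ext)
  then show "adj (mat_exp A) $$ (i, j) = mat_exp (adj A) $$ (i, j)"
    using ij mat_exp_carrier[OF A] by simp
qed (use A in \<open>auto simp: mat_exp_def\<close>)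

text \<open>The induction step of the binomial theorem, detached from powers: \<open>g i j\<close>
  stands for a term in which one operation has been applied \<open>i\<close> times and the other
  \<open>j\<close> times.\<close>

lemma pascal_sum:
  fixes g :: "nat \<Rightarrow> nat \<Rightarrow> 'a::comm_semiring_1"
  shows "(\<Sum>i\<le>Suc m. of_nat (Suc m choose i) * g i (Suc m - i)) =
    (\<Sum>i\<le>m. of_nat (m choose i) * g i (Suc (m - i))) + (\<Sum>i\<le>m. of_nat (m choose i) * g (Suc i) (m - i))"
proof -
  have "(\<Sum>i\<le>m. of_nat (m choose i) * g i (Suc (m - i))) = (\<Sum>i\<le>m. of_nat (m choose i) * g i (Suc m - i))"
    by (intro sum.cong) (auto simp: Suc_diff_le)
  also have "\<dots> = (\<Sum>i\<le>Suc m. of_nat (m choose i) * g i (Suc m - i))"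
    by (simp add: binomial_eq_0)
  also have "\<dots> = g 0 (Suc m) + (\<Sum>i\<le>m. of_nat (m choose Suc i) * g (Suc i) (m - i))"
    by (simp only: sum.atMost_Suc_shift) simp
  finally show ?thesis
    by (simp only: sum.atMost_Suc_shift) (simp add: distrib_right sum.distrib add_ac)
qed

text \<open>With \<open>L\<close> acting on the index of the family \<open>X\<close>, the hypothesis reads \<open>K1 X = X K2 + L X\<close>: left
  multiplication by \<open>K1\<close> is the sum of two commuting operations, so its powers follow the binomial
  theorem and its exponential factorises.\<close>

context
  fixes K1 K2 L :: "complex mat" and X :: "nat \<Rightarrow> complex mat" and p q N :: nat
  assumes K1: "K1 \<in> carrier_mat p p" and K2: "K2 \<in> carrier_mat q q" and L: "L \<in> carrier_mat N N"
    and X: "\<And>k. k < N \<Longrightarrow> X k \<in> carrier_mat p q"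
    and rel: "\<And>k a b. k < N \<Longrightarrow> a < p \<Longrightarrow> b < q \<Longrightarrow>
      (K1 * X k) $$ (a, b) = (X k * K2) $$ (a, b) + (\<Sum>l<N. L $$ (k, l) * X l $$ (a, b))"
begin

lemma intertwine_pow:
  assumes "k < N" "a < p" "b < q"
  shows "(K1 ^\<^sub>m m * X k) $$ (a, b) =
    (\<Sum>i\<le>m. of_nat (m choose i) * (\<Sum>l<N. (L ^\<^sub>m i) $$ (k, l) * (X l * K2 ^\<^sub>m (m - i)) $$ (a, b)))"
  using assms
proof (induction m arbitrary: k a b)
  case 0
  then have "(\<Sum>l<N. 1\<^sub>m N $$ (k, l) * X l $$ (a, b)) = X k $$ (a, b)"
    by (simp add: if_distrib[of "\<lambda>x. x * _"] cong: if_cong)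
  then show ?case
    using 0 K1 K2 L X[OF 0(1)] X right_mult_one_mat[OF X] left_mult_one_mat[OF X] by simp
next
  case (Suc m)
  note kab = Suc.prems
  note Xk = X[OF kab(1)]
  let ?g = "\<lambda>i n. \<Sum>l<N. (L ^\<^sub>m i) $$ (k, l) * (X l * K2 ^\<^sub>m n) $$ (a, b)"
  have step: "(X l * K2 ^\<^sub>m Suc n) $$ (a, b) = (\<Sum>c<q. (X l * K2 ^\<^sub>m n) $$ (a, c) * K2 $$ (c, b))" if "l < N" for l n
    using mat_mult_index[OF mult_carrier_mat[OF X pow_mat_carrier[OF K2]] K2 kab(2,3)]
      assoc_mult_mat[OF X pow_mat_carrier[OF K2] K2] that by simp
  have Lstep: "(L ^\<^sub>m Suc i) $$ (k, l) = (\<Sum>l'<N. L $$ (k, l') * (L ^\<^sub>m i) $$ (l', l))" if "l < N" for i l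
    unfolding pow_mat_Suc_left[OF L] using mat_mult_index[OF L pow_mat_carrier[OF L] kab(1) that] .
  \<comment> \<open>The additional \<open>K1\<close> is moved next to \<open>X k\<close>, where the
    relation trades it for \<open>K2\<close> on the right plus a row of \<open>L\<close>. These two
    contributions become the two sums of \<open>pascal_sum\<close>.\<close>
  have "(K1 ^\<^sub>m Suc m * X k) $$ (a, b) = (K1 ^\<^sub>m m * (K1 * X k)) $$ (a, b)"
    using assoc_mult_mat[OF pow_mat_carrier[OF K1] K1 Xk] by simp
  also have "\<dots> = (\<Sum>c<p. (K1 ^\<^sub>m m) $$ (a, c) * ((X k * K2) $$ (c, b) + (\<Sum>l<N. L $$ (k, l) * X l $$ (c, b))))"
    using mat_mult_index[OF pow_mat_carrier[OF K1] mult_carrier_mat[OF K1 Xk] kab(2,3)] rel[OF kab(1) _ kab(3)] by simp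
  also have "\<dots> = (K1 ^\<^sub>m m * (X k * K2)) $$ (a, b) + (\<Sum>c<p. \<Sum>l<N. L $$ (k, l) * ((K1 ^\<^sub>m m) $$ (a, c) * X l $$ (c, b)))"
    using mat_mult_index[OF pow_mat_carrier[OF K1] mult_carrier_mat[OF Xk K2] kab(2,3)]
    by (simp add: distrib_left sum.distrib sum_distrib_left mult_ac)
  also have "(\<Sum>c<p. \<Sum>l<N. L $$ (k, l) * ((K1 ^\<^sub>m m) $$ (a, c) * X l $$ (c, b))) =
      (\<Sum>l<N. L $$ (k, l) * (K1 ^\<^sub>m m * X l) $$ (a, b))"
    by (subst sum.swap)
      (simp add: mat_mult_index[OF pow_mat_carrier[OF K1] X kab(2,3)] sum_distrib_left)
  also have "\<dots> = (\<Sum>l<N. \<Sum>i\<le>m. \<Sum>l'<N. of_nat (m choose i) * (L $$ (k, l) * (L ^\<^sub>m i) $$ (l, l') * (X l' * K2 ^\<^sub>m (m - i)) $$ (a, b)))"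
    using Suc.IH[OF _ kab(2,3)] by (simp add: sum_distrib_left mult_ac)
  also have "\<dots> = (\<Sum>i\<le>m. \<Sum>l<N. \<Sum>l'<N. of_nat (m choose i) * (L $$ (k, l) * (L ^\<^sub>m i) $$ (l, l') * (X l' * K2 ^\<^sub>m (m - i)) $$ (a, b)))"
    by (rule sum.swap)
  also have "\<dots> = (\<Sum>i\<le>m. \<Sum>l'<N. \<Sum>l<N. of_nat (m choose i) * (L $$ (k, l) * (L ^\<^sub>m i) $$ (l, l') * (X l' * K2 ^\<^sub>m (m - i)) $$ (a, b)))"
    by (intro sum.cong refl sum.swap)
  also have "\<dots> = (\<Sum>i\<le>m. of_nat (m choose i) * ?g (Suc i) (m - i))"
    using Lstep by (simp add: sum_distrib_left sum_distrib_right del: pow_mat.simps)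
  also have "(K1 ^\<^sub>m m * (X k * K2)) $$ (a, b) = (\<Sum>c<q. (K1 ^\<^sub>m m * X k) $$ (a, c) * K2 $$ (c, b))"
    using mat_mult_index[OF mult_carrier_mat[OF pow_mat_carrier[OF K1] Xk] K2 kab(2,3)]
      assoc_mult_mat[OF pow_mat_carrier[OF K1] Xk K2] by simp
  also have "\<dots> = (\<Sum>c<q. \<Sum>i\<le>m. \<Sum>l<N. of_nat (m choose i) * ((L ^\<^sub>m i) $$ (k, l) * ((X l * K2 ^\<^sub>m (m - i)) $$ (a, c) * K2 $$ (c, b))))"
    using Suc.IH[OF kab(1,2)] by (simp add: sum_distrib_left sum_distrib_right mult_ac)
  also have "\<dots> = (\<Sum>i\<le>m. \<Sum>c<q. \<Sum>l<N. of_nat (m choose i) * ((L ^\<^sub>m i) $$ (k, l) * ((X l * K2 ^\<^sub>m (m - i)) $$ (a, c) * K2 $$ (c, b))))"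
    by (rule sum.swap)
  also have "\<dots> = (\<Sum>i\<le>m. \<Sum>l<N. \<Sum>c<q. of_nat (m choose i) * ((L ^\<^sub>m i) $$ (k, l) * ((X l * K2 ^\<^sub>m (m - i)) $$ (a, c) * K2 $$ (c, b))))"
    by (intro sum.cong refl sum.swap)
  also have "\<dots> = (\<Sum>i\<le>m. of_nat (m choose i) * ?g i (Suc (m - i)))"
    using step by (simp add: sum_distrib_left del: pow_mat.simps)
  finally show ?case unfolding pascal_sum[where g = ?g] .
qed

lemma intertwine_mat_exp:
  assumes kab: "k < N" "a < p" "b < q"
  shows "(mat_exp K1 * X k) $$ (a, b) = (\<Sum>l<N. mat_exp L $$ (k, l) * (X l * mat_exp K2) $$ (a, b))"
proof -
  have right: "(\<lambda>m. (X l * K2 ^\<^sub>m m) $$ (a, b) / fact m) sums (X l * mat_exp K2) $$ (a, b)"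
    and right_summable: "summable (\<lambda>m. cmod ((X l * K2 ^\<^sub>m m) $$ (a, b) / fact m))" if l: "l < N" for l
  proof -
    have *: "(X l * K2 ^\<^sub>m m) $$ (a, b) / fact m = (\<Sum>c<q. X l $$ (a, c) * ((K2 ^\<^sub>m m) $$ (c, b) / fact m))" for m
      using mat_mult_index[OF X[OF l] pow_mat_carrier[OF K2] kab(2,3)] by (simp add: sum_divide_distrib)
    show "(\<lambda>m. (X l * K2 ^\<^sub>m m) $$ (a, b) / fact m) sums (X l * mat_exp K2) $$ (a, b)"
      unfolding * mat_mult_index[OF X[OF l] mat_exp_carrier[OF K2] kab(2,3)]
      by (intro sums_sum sums_mult mat_exp_sums[OF K2]) (use kab in auto)
    show "summable (\<lambda>m. cmod ((X l * K2 ^\<^sub>m m) $$ (a, b) / fact m))"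
    proof (rule summable_comparison_test')
      show "summable (\<lambda>m. \<Sum>c<q. cmod (X l $$ (a, c)) * cmod ((K2 ^\<^sub>m m) $$ (c, b) / fact m))"
        using kab by (intro summable_sum summable_mult summable_mat_exp[OF K2]) auto
      show "norm (cmod ((X l * K2 ^\<^sub>m m) $$ (a, b) / fact m)) \<le>
          (\<Sum>c<q. cmod (X l $$ (a, c)) * cmod ((K2 ^\<^sub>m m) $$ (c, b) / fact m))" if "0 \<le> m" for m
        unfolding * by (simp add: sum_norm_le norm_mult del: times_divide_eq_right)
    qed
  qed
  \<comment> \<open>For each \<open>l\<close>, the Cauchy product of the series of an entry of
    \<open>exp L\<close> with that of \<open>X l * exp K2\<close>. Dividing
    \<open>m choose i\<close> by \<open>fact m\<close> leaves exactly the two factorials in its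
    terms.\<close>
  have "(\<lambda>m. \<Sum>l<N. \<Sum>i\<le>m. (L ^\<^sub>m i) $$ (k, l) / fact i * ((X l * K2 ^\<^sub>m (m - i)) $$ (a, b) / fact (m - i)))
    sums (\<Sum>l<N. (\<Sum>i. (L ^\<^sub>m i) $$ (k, l) / fact i) * (\<Sum>i. (X l * K2 ^\<^sub>m i) $$ (a, b) / fact i))"
    using kab by (intro sums_sum Cauchy_product_sums summable_mat_exp[OF L] right_summable) auto
  also have "(\<Sum>l<N. (\<Sum>i. (L ^\<^sub>m i) $$ (k, l) / fact i) * (\<Sum>i. (X l * K2 ^\<^sub>m i) $$ (a, b) / fact i)) =
    (\<Sum>l<N. mat_exp L $$ (k, l) * (X l * mat_exp K2) $$ (a, b))"
    by (intro sum.cong refl arg_cong2[of _ _ _ _ "(*)"] sums_unique[symmetric] mat_exp_sums[OF L] right)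
      (use kab in auto)
  also have "(\<lambda>m. \<Sum>l<N. \<Sum>i\<le>m. (L ^\<^sub>m i) $$ (k, l) / fact i * ((X l * K2 ^\<^sub>m (m - i)) $$ (a, b) / fact (m - i))) =
    (\<lambda>m. (K1 ^\<^sub>m m * X k) $$ (a, b) / fact m)"
  proof
    fix m
    have "(\<Sum>l<N. \<Sum>i\<le>m. (L ^\<^sub>m i) $$ (k, l) / fact i * ((X l * K2 ^\<^sub>m (m - i)) $$ (a, b) / fact (m - i))) =
      (\<Sum>i\<le>m. \<Sum>l<N. (L ^\<^sub>m i) $$ (k, l) / fact i * ((X l * K2 ^\<^sub>m (m - i)) $$ (a, b) / fact (m - i)))"
      by (rule sum.swap)
    also have "\<dots> = (\<Sum>i\<le>m. of_nat (m choose i) * (\<Sum>l<N. (L ^\<^sub>m i) $$ (k, l) * (X l * K2 ^\<^sub>m (m - i)) $$ (a, b)) / fact m)"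
      by (intro sum.cong refl) (simp add: binomial_fact sum_distrib_left sum_divide_distrib mult_ac)
    finally show "(\<Sum>l<N. \<Sum>i\<le>m. (L ^\<^sub>m i) $$ (k, l) / fact i * ((X l * K2 ^\<^sub>m (m - i)) $$ (a, b) / fact (m - i))) =
      (K1 ^\<^sub>m m * X k) $$ (a, b) / fact m"
      by (simp add: intertwine_pow[OF kab] sum_divide_distrib)
  qed
  finally have "(\<lambda>m. (K1 ^\<^sub>m m * X k) $$ (a, b) / fact m) sums
    (\<Sum>l<N. mat_exp L $$ (k, l) * (X l * mat_exp K2) $$ (a, b))" .
  moreover have "(\<lambda>m. (K1 ^\<^sub>m m * X k) $$ (a, b) / fact m) sums (mat_exp K1 * X k) $$ (a, b)"
  proof -
    have *: "(K1 ^\<^sub>m m * X k) $$ (a, b) / fact m = (\<Sum>c<p. ((K1 ^\<^sub>m m) $$ (a, c) / fact m) * X k $$ (c, b))" for m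
      using mat_mult_index[OF pow_mat_carrier[OF K1] X[OF kab(1)] kab(2,3)] by (simp add: sum_divide_distrib)
    show ?thesis
      unfolding * mat_mult_index[OF mat_exp_carrier[OF K1] X[OF kab(1)] kab(2,3)]
      by (intro sums_sum sums_mult2 mat_exp_sums[OF K1]) (use kab in auto)
  qed
  ultimately show ?thesis by (rule sums_unique2[symmetric])
qed

end

text \<open>The rows of the identity intertwine \<open>0\<close> and \<open>K\<close> with coefficient matrix \<open>- K\<close>.\<close>

lemma mat_exp_uminus_mult:
  assumes K: "K \<in> carrier_mat d d"
  shows "mat_exp (- K) * mat_exp K = 1\<^sub>m d"
proof (rule eq_matI)
  fix k b assume "k < dim_row (1\<^sub>m d)" "b < dim_col (1\<^sub>m d)"
  then have kb: "k < d" "b < d" by auto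
  define X where "X k = mat 1 d (\<lambda>(_, j). if j = k then 1 else 0 :: complex)" for k
  have X: "X k \<in> carrier_mat 1 d" for k by (simp add: X_def)
  have XA: "(X l * A) $$ (0, j) = A $$ (l, j)" if "A \<in> carrier_mat d d" "l < d" "j < d" for A l j
    using mat_mult_index[OF X that(1) _ that(3), of 0 l] that
    by (simp add: X_def if_distrib[of "\<lambda>x. x * _"] cong: if_cong)
  have "(0\<^sub>m 1 1 * X k) $$ (a, b) = (X k * K) $$ (a, b) + (\<Sum>l<d. (- K) $$ (k, l) * X l $$ (a, b))"
    if "k < d" "a < 1" "b < d" for k a b
  proof -
    have "(\<Sum>l<d. (- K) $$ (k, l) * X l $$ (0, b)) = - K $$ (k, b)"
      using that K by (simp add: X_def if_distrib[of "\<lambda>x. _ * x"] cong: if_cong)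
    moreover have "(0\<^sub>m 1 1 * X k) $$ (0, b) = 0"
      using mat_mult_index[OF zero_carrier_mat X _ that(3), of 0 1 k] by simp
    ultimately show ?thesis using XA[OF K] that by simp
  qed
  from intertwine_mat_exp[where p = 1 and q = d and N = d and L = "- K" and X = X and b = b and k = k and a = 0,
      OF zero_carrier_mat K _ X this]
  have "(mat_exp (0\<^sub>m 1 1) * X k) $$ (0, b) = (\<Sum>l<d. mat_exp (- K) $$ (k, l) * (X l * mat_exp K) $$ (0, b))"
    using K kb by simp
  also have "\<dots> = (mat_exp (- K) * mat_exp K) $$ (k, b)"
    using mat_mult_index[OF mat_exp_carrier mat_exp_carrier[OF K] kb, of "- K"] XA[OF mat_exp_carrier[OF K]] kb K
    by simp
  finally have eq: "(mat_exp (- K) * mat_exp K) $$ (k, b) = (mat_exp (0\<^sub>m 1 1) * X k) $$ (0, b)" by simp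
  \<comment> \<open>What is left is the exponential of the 1 x 1 zero matrix, whose series consists
    of its first term.\<close>
  have "((0\<^sub>m 1 1 :: complex mat) ^\<^sub>m m) $$ (0, 0) = (if m = 0 then 1 else 0)" for m
    by (cases m) (auto simp: scalar_prod_def)
  then have "(\<lambda>m. if m = 0 then 1 else 0) sums mat_exp (0\<^sub>m 1 1) $$ (0, 0)"
    using mat_exp_sums[of "0\<^sub>m 1 1" 1 0 0] by (simp add: if_distrib[of "\<lambda>x. x / _"] cong: if_cong)
  moreover have "(\<lambda>m::nat. if m = 0 then 1 else 0 :: complex) sums 1"
    by (rule sums_single)
  ultimately have "mat_exp (0\<^sub>m 1 1) $$ (0, 0) = 1"
    by (rule sums_unique2)
  then show "(mat_exp (- K) * mat_exp K) $$ (k, b) = 1\<^sub>m d $$ (k, b)"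
    unfolding eq using mat_mult_index[OF mat_exp_carrier X _ kb(2), of "0\<^sub>m 1 1" 0 k] kb by (simp add: X_def)
qed (use K mat_exp_carrier[OF K] mat_exp_carrier[of "- K" d] in auto)

section \<open>Heisenberg dynamics generated by a Hermitian matrix\<close>

context
  fixes H :: "complex mat" and d :: nat
  assumes H: "H \<in> carrier_mat d d" and hermitian: "adj H = H"
begin

definition evol :: "real \<Rightarrow> complex mat" where
  "evol t = mat_exp ((\<i> * complex_of_real t) \<cdot>\<^sub>m H)"

lemma evol_carrier: "evol t \<in> carrier_mat d d"
  using H by (auto simp: evol_def intro!: mat_exp_carrier)

lemma evol_inverse: "evol t * evol (- t) = 1\<^sub>m d"
proof -
  have "(\<i> * complex_of_real t) \<cdot>\<^sub>m H = - ((\<i> * complex_of_real (- t)) \<cdot>\<^sub>m H)"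
    by (intro eq_matI) auto
  then show ?thesis
    unfolding evol_def using H by (simp only: mat_exp_uminus_mult[OF smult_carrier_mat])
qed

lemma adj_evol: "adj (evol t) = evol (- t)"
proof -
  have "adj ((\<i> * complex_of_real t) \<cdot>\<^sub>m H) = (\<i> * complex_of_real (- t)) \<cdot>\<^sub>m adj H"
    by (intro eq_matI) auto
  then show ?thesis
    unfolding evol_def using H hermitian by (simp add: adj_mat_exp[of _ d])
qed

lemma op_norm_evol: "op_norm (evol t) \<le> 1"
  using evol_inverse[of "- t"] by (intro op_norm_unitary[OF evol_carrier]) (simp add: adj_evol)

lemma heisenberg_evol: "heisenberg H t A = evol t * A * evol (- t)"
  by (simp add: heisenberg_def evol_def)

lemma heisenberg_carrier: "A \<in> carrier_mat d d \<Longrightarrow> heisenberg H t A \<in> carrier_mat d d"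
  unfolding heisenberg_evol by (intro mult_carrier_mat[of _ d d] evol_carrier)

lemma heisenberg_mult:
  assumes A: "A \<in> carrier_mat d d" and B: "B \<in> carrier_mat d d"
  shows "heisenberg H t (A * B) = heisenberg H t A * heisenberg H t B"
proof -
  note a = assoc_mult_mat[of _ d d _ d _ d]
  note c = A B evol_carrier mult_carrier_mat[of _ d d]
  \<comment> \<open>The inner factor \<open>evol t\<close> is written \<open>evol (- (- t))\<close>
    so that \<open>evol_inverse\<close> applies at time \<open>- t\<close>.\<close>
  have "heisenberg H t A * heisenberg H t B = evol t * A * (evol (- t) * evol (- (- t))) * B * evol (- t)"
    unfolding heisenberg_evol by (simp add: a c)
  also have "\<dots> = evol t * (A * B) * evol (- t)"
    unfolding evol_inverse using c left_mult_one_mat[OF mult_carrier_mat[OF B evol_carrier]] by (simp add: a c)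
  finally show ?thesis unfolding heisenberg_evol by simp
qed

lemma adj_heisenberg:
  assumes A: "A \<in> carrier_mat d d"
  shows "adj (heisenberg H t A) = heisenberg H t (adj A)"
proof -
  have "adj (evol t * A * evol (- t)) = adj (evol (- t)) * (adj A * adj (evol t))"
    using adj_mult[OF mult_carrier_mat[OF evol_carrier A] evol_carrier] adj_mult[OF evol_carrier A] by simp
  then show ?thesis unfolding heisenberg_evol adj_evol
    using assoc_mult_mat[OF evol_carrier adj_carrier[OF A] evol_carrier] by simp
qed

lemma heisenberg_add:
  assumes "A \<in> carrier_mat d d" "B \<in> carrier_mat d d"
  shows "heisenberg H t (A + B) = heisenberg H t A + heisenberg H t B"
  unfolding heisenberg_evol mult_add_distrib_mat[OF evol_carrier assms]
  by (rule add_mult_distrib_mat[OF mult_carrier_mat[OF evol_carrier assms(1)] mult_carrier_mat[OF evol_carrier assms(2)] evol_carrier])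

lemma heisenberg_smult:
  assumes "A \<in> carrier_mat d d"
  shows "heisenberg H t (c \<cdot>\<^sub>m A) = c \<cdot>\<^sub>m heisenberg H t A"
  unfolding heisenberg_evol mult_smult_distrib[OF evol_carrier assms]
  by (rule mult_smult_assoc_mat[OF mult_carrier_mat[OF evol_carrier assms] evol_carrier])

lemma op_norm_heisenberg_le_1:
  assumes "A \<in> carrier_mat d d" "op_norm A \<le> 1"
  shows "op_norm (heisenberg H t A) \<le> 1"
proof -
  have "op_norm (heisenberg H t A) \<le> op_norm (evol t) * op_norm A * op_norm (evol (- t))"
    unfolding heisenberg_evol
    using op_norm_mult[OF mult_carrier_mat[OF evol_carrier assms(1)] evol_carrier]
      op_norm_mult[OF evol_carrier assms(1)] by (meson mult_right_mono op_norm_nonneg order_trans)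
  also have "\<dots> \<le> 1 * 1 * 1"
    by (intro mult_mono op_norm_evol assms) auto
  finally show ?thesis by simp
qed

text \<open>The relation says that \<open>H X = X H + G X\<close>, so
  \<open>intertwine_mat_exp\<close> with both \<open>K1\<close> and \<open>K2\<close> equal to
  \<open>i t H\<close> and \<open>L\<close> equal to \<open>i t G\<close> gives
  \<open>exp(itH) X = exp(itG) X exp(itH)\<close>. Multiplying by \<open>exp(-itH)\<close> from the
  right turns the left side into the evolution of \<open>X\<close>. This is how the dynamics on a
  space of dimension \<open>2 ^ n\<close> reduces to an exponential of size
  \<open>N\<close>.\<close>

lemma heisenberg_linear_orbit:
  assumes G: "G \<in> carrier_mat N N" and X: "\<And>k. k < N \<Longrightarrow> X k \<in> carrier_mat d d"
    and rel: "\<And>k. k < N \<Longrightarrow> commutator H (X k) = sum_mat d (\<lambda>l. G $$ (k, l) \<cdot>\<^sub>m X l) {..<N}"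
    and k: "k < N"
  shows "heisenberg H t (X k) =
    sum_mat d (\<lambda>l. mat_exp ((\<i> * complex_of_real t) \<cdot>\<^sub>m G) $$ (k, l) \<cdot>\<^sub>m X l) {..<N}"
proof -
  let ?z = "\<i> * complex_of_real t"
  let ?S = "sum_mat d (\<lambda>l. mat_exp (?z \<cdot>\<^sub>m G) $$ (k, l) \<cdot>\<^sub>m X l) {..<N}"
  have "(?z \<cdot>\<^sub>m H * X k) $$ (a, b) = (X k * (?z \<cdot>\<^sub>m H)) $$ (a, b) + (\<Sum>l<N. (?z \<cdot>\<^sub>m G) $$ (k, l) * X l $$ (a, b))"
    if *: "k < N" "a < d" "b < d" for k a b
  proof -
    have "(H * X k) $$ (a, b) - (X k * H) $$ (a, b) = (\<Sum>l<N. G $$ (k, l) * X l $$ (a, b))"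
      using arg_cong[OF rel[OF *(1)], of "\<lambda>A. A $$ (a, b)"] * X H by (simp add: commutator_def carrier_matD[OF X])
    then have "?z * (H * X k) $$ (a, b) = ?z * (X k * H) $$ (a, b) + (\<Sum>l<N. ?z * G $$ (k, l) * X l $$ (a, b))"
      by (simp add: sum_distrib_left[symmetric] mult.assoc distrib_left[symmetric] diff_eq_eq add.commute del: mult_cancel_left)
    then show ?thesis
      unfolding mult_smult_assoc_mat[OF H X[OF *(1)]] mult_smult_distrib[OF X[OF *(1)] H]
      using * G H X[OF *(1)] by (simp add: carrier_matD[OF X])
  qed
  then have E: "(evol t * X k) $$ (a, b) = (\<Sum>l<N. mat_exp (?z \<cdot>\<^sub>m G) $$ (k, l) * (X l * evol t) $$ (a, b))"
    if "a < d" "b < d" for a b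
    unfolding evol_def
    by (intro intertwine_mat_exp[where p = d and q = d] smult_carrier_mat H G X k that) auto
  have "evol t * X k = ?S * evol t"
  proof (rule eq_matI)
    fix a b assume "a < dim_row (?S * evol t)" "b < dim_col (?S * evol t)"
    then have ab: "a < d" "b < d" using evol_carrier[of t] by (auto simp: sum_mat_def)
    have "(?S * evol t) $$ (a, b) = (\<Sum>c<d. \<Sum>l<N. mat_exp (?z \<cdot>\<^sub>m G) $$ (k, l) * (X l $$ (a, c) * evol t $$ (c, b)))"
      unfolding mat_mult_index[OF sum_mat_carrier evol_carrier ab] using ab
      by (intro sum.cong refl) (auto simp: sum_distrib_right carrier_matD[OF X] mult.assoc intro!: sum.cong)
    also have "\<dots> = (\<Sum>l<N. \<Sum>c<d. mat_exp (?z \<cdot>\<^sub>m G) $$ (k, l) * (X l $$ (a, c) * evol t $$ (c, b)))"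
      by (rule sum.swap)
    also have "\<dots> = (\<Sum>l<N. mat_exp (?z \<cdot>\<^sub>m G) $$ (k, l) * (X l * evol t) $$ (a, b))"
      using mat_mult_index[OF X evol_carrier ab] by (simp add: sum_distrib_left)
    also have "\<dots> = (evol t * X k) $$ (a, b)"
      using E[OF ab] by simp
    finally show "(evol t * X k) $$ (a, b) = (?S * evol t) $$ (a, b)" by simp
  qed (use evol_carrier[of t] X[OF k] in \<open>auto simp: sum_mat_def\<close>)
  then have "heisenberg H t (X k) = ?S * (evol t * evol (- t))"
    unfolding heisenberg_evol
    using assoc_mult_mat[OF sum_mat_carrier evol_carrier evol_carrier] by simp
  then show ?thesis unfolding evol_inverse using right_mult_one_mat[OF sum_mat_carrier] by simp
qed

end

section \<open>The Jordan-Wigner transform\<close>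

lemma mat2_eqI:
  assumes "A \<in> carrier_mat 2 2" "B \<in> carrier_mat 2 2"
    and "A $$ (0, 0) = B $$ (0, 0)" "A $$ (0, 1) = B $$ (0, 1)" "A $$ (1, 0) = B $$ (1, 0)" "A $$ (1, 1) = B $$ (1, 1)"
  shows "A = B"
  using assms by (intro eq_matI) (auto simp: less_2_cases_iff)

lemma sum_atLeast0LessThan_2: "(\<Sum>i = 0..<2. f i) = f 0 + f (1::nat)"
  for f :: "nat \<Rightarrow> complex"
  by (simp add: numeral_2_eq_2)

text \<open>\<open>ladder True\<close> is the lowering matrix \<open>a\<close> and \<open>ladder False\<close> is \<open>a\<^sup>*\<close>; below, \<open>jw n j (ladder True)\<close> is
  \<open>c\<^sub>j\<close> and \<open>jw n j (ladder False)\<close> is \<open>c\<^sub>j\<^sup>*\<close>.\<close>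

definition ladder :: "bool \<Rightarrow> complex mat" where
  "ladder s = (if s then mat_of_rows_list 2 [[0, 0], [1, 0]] else mat_of_rows_list 2 [[0, 1], [0, 0]])"

text \<open>The sign by which \<open>a\<close> and its adjoint differ in the relations below; with
  it each of them is stated once for both.\<close>

definition sg :: "bool \<Rightarrow> complex" where
  "sg s = (if s then 1 else -1)"

lemma pauli_carrier [simp]:
  "pauli_x \<in> carrier_mat 2 2" "pauli_y \<in> carrier_mat 2 2" "pauli_z \<in> carrier_mat 2 2"
  "ladder s \<in> carrier_mat 2 2"
  by (auto simp: pauli_x_def pauli_y_def pauli_z_def ladder_def mat_of_rows_list_def)

lemma pauli_dim [simp]:
  "dim_row pauli_x = 2" "dim_row pauli_y = 2" "dim_row pauli_z = 2" "dim_row (ladder s) = 2"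
  "dim_col pauli_x = 2" "dim_col pauli_y = 2" "dim_col pauli_z = 2" "dim_col (ladder s) = 2"
  using pauli_carrier by (auto simp del: pauli_carrier)

lemma pauli_index [simp]:
  "pauli_x $$ (0, 0) = 0" "pauli_x $$ (0, Suc 0) = 1" "pauli_x $$ (Suc 0, 0) = 1" "pauli_x $$ (Suc 0, Suc 0) = 0"
  "pauli_y $$ (0, 0) = 0" "pauli_y $$ (0, Suc 0) = - \<i>" "pauli_y $$ (Suc 0, 0) = \<i>" "pauli_y $$ (Suc 0, Suc 0) = 0"
  "pauli_z $$ (0, 0) = 1" "pauli_z $$ (0, Suc 0) = 0" "pauli_z $$ (Suc 0, 0) = 0" "pauli_z $$ (Suc 0, Suc 0) = -1"
  "ladder s $$ (0, 0) = 0" "ladder s $$ (0, Suc 0) = (if s then 0 else 1)"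
  "ladder s $$ (Suc 0, 0) = (if s then 1 else 0)" "ladder s $$ (Suc 0, Suc 0) = 0"
  by (auto simp: pauli_x_def pauli_y_def pauli_z_def ladder_def mat_of_rows_list_def)

section \<open>Relations between Pauli and ladder matrices\<close>

lemma pauli_x_ladder_comm: "pauli_x * ladder s - ladder s * pauli_x = sg s \<cdot>\<^sub>m pauli_z"
  by (rule mat2_eqI) (auto simp: scalar_prod_def sum_atLeast0LessThan_2 sg_def)

lemma pauli_y_ladder_comm: "pauli_y * ladder s - ladder s * pauli_y = (- \<i>) \<cdot>\<^sub>m pauli_z"
  by (rule mat2_eqI) (auto simp: scalar_prod_def sum_atLeast0LessThan_2 sg_def)

lemma pauli_x_ladder_anticomm: "pauli_x * ladder s + ladder s * pauli_x = 1 \<cdot>\<^sub>m 1\<^sub>m 2"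
  by (rule mat2_eqI) (auto simp: scalar_prod_def sum_atLeast0LessThan_2 sg_def)

lemma pauli_y_ladder_anticomm: "pauli_y * ladder s + ladder s * pauli_y = (- sg s * \<i>) \<cdot>\<^sub>m 1\<^sub>m 2"
  by (rule mat2_eqI) (auto simp: scalar_prod_def sum_atLeast0LessThan_2 sg_def)

lemma pauli_z_ladder: "pauli_z * ladder s - ladder s * pauli_z = (- 2 * sg s) \<cdot>\<^sub>m ladder s"
  by (rule mat2_eqI) (auto simp: scalar_prod_def sum_atLeast0LessThan_2 sg_def)

lemma pauli_z_pauli_x: "pauli_z * pauli_x = (-1) \<cdot>\<^sub>m (pauli_x * pauli_z)"
  by (rule mat2_eqI) (auto simp: scalar_prod_def sum_atLeast0LessThan_2)

lemma pauli_z_pauli_y: "pauli_z * pauli_y = (-1) \<cdot>\<^sub>m (pauli_y * pauli_z)"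
  by (rule mat2_eqI) (auto simp: scalar_prod_def sum_atLeast0LessThan_2)

text \<open>These four matrices are what a bond leaves at the neighbouring site, the first two to
  the right and the last two to the left. Expanding relative to \<open>s\<close> separates the
  ladder matrix of the same kind from the one of the opposite kind.\<close>

lemma pauli_eq_ladder:
  "pauli_x = ladder s + ladder (\<not> s)"
  "pauli_y = (\<i> * sg s) \<cdot>\<^sub>m ladder s + (- \<i> * sg s) \<cdot>\<^sub>m ladder (\<not> s)"
  "pauli_x * pauli_z = sg s \<cdot>\<^sub>m ladder s + (- sg s) \<cdot>\<^sub>m ladder (\<not> s)"
  "pauli_y * pauli_z = \<i> \<cdot>\<^sub>m ladder s + \<i> \<cdot>\<^sub>m ladder (\<not> s)"
  by (rule mat2_eqI, auto simp: scalar_prod_def sum_atLeast0LessThan_2 sg_def)+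

lemma pauli_z_square [simp]: "pauli_z * pauli_z = 1\<^sub>m 2"
  by (rule mat2_eqI) (auto simp: scalar_prod_def sum_atLeast0LessThan_2)

lemma pauli_z_eq_ladder: "pauli_z = 2 \<cdot>\<^sub>m (ladder False * ladder True) + (-1) \<cdot>\<^sub>m 1\<^sub>m 2"
  by (rule mat2_eqI) (auto simp: scalar_prod_def sum_atLeast0LessThan_2)

lemma ladder_anticommutator: "ladder (\<not> s) * ladder s + ladder s * ladder (\<not> s) = 1\<^sub>m 2"
  by (rule mat2_eqI) (auto simp: scalar_prod_def sum_atLeast0LessThan_2)

text \<open>The two products and the two ladder matrices are the four matrix units, so the
  coefficients are the entries of \<open>X\<close>.\<close>

lemma mat2_eq_ladder:
  assumes "X \<in> carrier_mat 2 2"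
  shows "X = (X $$ (0, 0) \<cdot>\<^sub>m (ladder False * ladder True) + X $$ (1, 1) \<cdot>\<^sub>m (ladder True * ladder False))
    + (X $$ (1, 0) \<cdot>\<^sub>m ladder True + X $$ (0, 1) \<cdot>\<^sub>m ladder False)"
  using assms by (intro mat2_eqI) (auto simp: scalar_prod_def sum_atLeast0LessThan_2)

lemma adj_pauli [simp]:
  "adj pauli_x = pauli_x" "adj pauli_y = pauli_y" "adj pauli_z = pauli_z" "adj (ladder s) = ladder (\<not> s)"
  "adj (1\<^sub>m 2) = 1\<^sub>m 2"
  by (rule mat2_eqI; auto)+

text \<open>The last slot takes any matrix \<open>x\<close>, because commutators with a bond first
  produce Pauli matrices there, which are expanded into ladder matrices afterwards.\<close>

definition jw :: "nat \<Rightarrow> nat \<Rightarrow> complex mat \<Rightarrow> complex mat" where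
  "jw n j x = site_prod n (\<lambda>i. if i < j then pauli_z else if i = j then x else 1\<^sub>m 2)"

lemma jw_carrier: "x \<in> carrier_mat 2 2 \<Longrightarrow> jw n j x \<in> carrier_mat (2 ^ n) (2 ^ n)"
  unfolding jw_def by (rule site_prod_carrier) auto

lemma jw_upd: "jw n j x = site_prod n ((\<lambda>i. if i < j then pauli_z else 1\<^sub>m 2)(j := x))"
  unfolding jw_def by (rule site_prod_cong) auto

lemma jw_add:
  assumes "x \<in> carrier_mat 2 2" "y \<in> carrier_mat 2 2" "1 \<le> j" "j \<le> n"
  shows "jw n j (x + y) = jw n j x + jw n j y"
  unfolding jw_upd using assms by (intro site_prod_add) auto

lemma jw_smult:
  assumes "1 \<le> j" "j \<le> n"
  shows "jw n j (c \<cdot>\<^sub>m x) = c \<cdot>\<^sub>m jw n j x"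
  unfolding jw_upd using assms by (rule site_prod_smult)

lemma site_prod_diff:
  assumes "\<And>i. f i \<in> carrier_mat 2 2" "X \<in> carrier_mat 2 2" "Y \<in> carrier_mat 2 2" "1 \<le> j" "j \<le> n"
  shows "site_prod n (f(j := X)) - site_prod n (f(j := Y)) = site_prod n (f(j := X - Y))"
proof -
  have "site_prod n (f(j := X - Y)) = site_prod n (f(j := X + (-1) \<cdot>\<^sub>m Y))"
    using assms by (intro arg_cong[of _ _ "\<lambda>Z. site_prod n (f(j := Z))"] eq_matI) auto
  also have "\<dots> = site_prod n (f(j := X)) + (-1) \<cdot>\<^sub>m site_prod n (f(j := Y))"
    using assms by (simp only: site_prod_add site_prod_smult smult_carrier_mat)
  moreover have "site_prod n (f(j := Y)) \<in> carrier_mat (2 ^ n) (2 ^ n)"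
    "site_prod n (f(j := X)) \<in> carrier_mat (2 ^ n) (2 ^ n)"
    using assms by (auto intro!: site_prod_carrier)
  ultimately show ?thesis by (intro eq_matI) auto
qed

lemma adj_jw: "adj (jw n j x) = jw n j (adj x)"
  unfolding jw_def adj_site_prod by (rule site_prod_cong) auto

text \<open>The two strings cancel, since \<open>pauli_z\<close> squares to the identity; quadratic
  expressions at one site are local.\<close>

lemma jw_mult:
  assumes "x \<in> carrier_mat 2 2" "y \<in> carrier_mat 2 2" "1 \<le> j" "j \<le> n"
  shows "jw n j x * jw n j y = embed n j j (x * y)"
  unfolding jw_def embed_eq_site_prod[OF assms(3,4)] using assms
  by (subst site_prod_mult) (auto intro!: site_prod_cong)

lemma embed_carrier:
  assumes "X \<in> carrier_mat 2 2" "1 \<le> j" "j \<le> n"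
  shows "embed n j j X \<in> carrier_mat (2 ^ n) (2 ^ n)"
  unfolding embed_eq_site_prod[OF assms(2,3)] using assms by (intro site_prod_carrier) auto

lemma embed_upd:
  assumes "1 \<le> j" "j \<le> n"
  shows "embed n j j X = site_prod n ((\<lambda>_. 1\<^sub>m 2)(j := X))"
  unfolding embed_eq_site_prod[OF assms] by (rule site_prod_cong) auto

lemma embed_add:
  assumes "X \<in> carrier_mat 2 2" "Y \<in> carrier_mat 2 2" "1 \<le> j" "j \<le> n"
  shows "embed n j j (X + Y) = embed n j j X + embed n j j Y"
  unfolding embed_upd[OF assms(3,4)] using assms by (intro site_prod_add) auto

lemma embed_smult:
  assumes "1 \<le> j" "j \<le> n"
  shows "embed n j j (c \<cdot>\<^sub>m X) = c \<cdot>\<^sub>m embed n j j X"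
  unfolding embed_upd[OF assms] using assms by (rule site_prod_smult)

lemma embed_one:
  assumes "1 \<le> j" "j \<le> n"
  shows "embed n j j (1\<^sub>m 2) = 1\<^sub>m (2 ^ n)"
  unfolding embed_eq_site_prod[OF assms] site_prod_one[symmetric] by (rule site_prod_cong) auto

text \<open>The canonical anticommutation relation at site \<open>j\<close> has precisely the form
  that \<open>op_norm_le_1\<close> asks for.\<close>

lemma op_norm_jw_ladder:
  assumes "1 \<le> j" "j \<le> n"
  shows "op_norm (jw n j (ladder s)) \<le> 1"
proof (rule op_norm_le_1[OF jw_carrier jw_carrier])
  show "adj (jw n j (ladder s)) * jw n j (ladder s) +
      adj (jw n j (ladder (\<not> s))) * jw n j (ladder (\<not> s)) = 1\<^sub>m (2 ^ n)"
    using assms ladder_anticommutator[of s]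
    by (simp add: adj_jw jw_mult embed_add[symmetric] embed_one mult_carrier_mat[of _ 2 2])
qed auto

text \<open>\<open>pauli_z\<close> commutes with the string and with the identities, so only the
  site \<open>l\<close> itself can contribute.\<close>

lemma site_commutator_jw:
  assumes j: "1 \<le> j" "j \<le> n" and l: "1 \<le> l" "l \<le> n"
  shows "commutator (embed n j j pauli_z) (jw n l (ladder s)) =
    (if j = l then (- 2 * sg s) \<cdot>\<^sub>m jw n l (ladder s) else 0\<^sub>m (2 ^ n) (2 ^ n))"
proof -
  let ?f = "\<lambda>i. if i = j then pauli_z else 1\<^sub>m 2"
  let ?g = "\<lambda>i. if i < l then pauli_z else if i = l then ladder s else 1\<^sub>m 2"
  have c: "commutator (embed n j j pauli_z) (jw n l (ladder s)) =
      site_prod n (\<lambda>i. ?f i * ?g i) - site_prod n (\<lambda>i. ?g i * ?f i)"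
    unfolding commutator_def embed_eq_site_prod[OF j] jw_def
    by (subst (1 2) site_prod_mult) auto
  show ?thesis
  proof (cases "j = l")
    case True
    let ?h = "\<lambda>i. if i < l then pauli_z else 1\<^sub>m 2"
    have "site_prod n (\<lambda>i. ?f i * ?g i) = site_prod n (?h(l := pauli_z * ladder s))"
      "site_prod n (\<lambda>i. ?g i * ?f i) = site_prod n (?h(l := ladder s * pauli_z))"
      using True by (auto intro!: site_prod_cong)
    then have "commutator (embed n j j pauli_z) (jw n l (ladder s)) = jw n l ((- 2 * sg s) \<cdot>\<^sub>m ladder s)"
      unfolding c pauli_z_ladder[symmetric] jw_upd[of n l "_ - _"] using l
      by (simp only:) (intro site_prod_diff mult_carrier_mat[of _ 2 2], auto)
    then show ?thesis using True jw_smult[OF l] by simp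
  next
    case False
    then have "site_prod n (\<lambda>i. ?f i * ?g i) = site_prod n (\<lambda>i. ?g i * ?f i)"
      by (intro site_prod_cong) auto
    moreover have "site_prod n (\<lambda>i. ?g i * ?f i) \<in> carrier_mat (2 ^ n) (2 ^ n)"
      by (intro site_prod_carrier mult_carrier_mat[of _ 2 2]) auto
    ultimately show ?thesis using False unfolding c by auto
  qed
qed

lemma bond_eq_site_prod:
  assumes "1 \<le> j" "j < n" "w \<in> carrier_mat 2 2"
  shows "embed n j j w * embed n (j + 1) (j + 1) w = site_prod n (\<lambda>i. if i = j \<or> i = j + 1 then w else 1\<^sub>m 2)"
proof -
  have "embed n j j w * embed n (j + 1) (j + 1) w =
    site_prod n (\<lambda>i. if i = j then w else 1\<^sub>m 2) * site_prod n (\<lambda>i. if i = j + 1 then w else 1\<^sub>m 2)"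
    using assms by (simp add: embed_eq_site_prod)
  also have "\<dots> = site_prod n (\<lambda>i. if i = j \<or> i = j + 1 then w else 1\<^sub>m 2)"
    using assms by (subst site_prod_mult) (auto intro!: site_prod_cong)
  finally show ?thesis .
qed

text \<open>The position of the bond relative to \<open>l\<close> decides how many signs arise when
  \<open>w\<close> passes the string. If the bond starts at \<open>l\<close> there is no sign: the
  commutator leaves \<open>pauli_z\<close> at \<open>l\<close>, which prolongs the string by one
  site. If it ends at \<open>l\<close>, \<open>w\<close> passes one \<open>pauli_z\<close> at
  \<open>j\<close>, and this single sign turns the commutator at \<open>l\<close> into an
  anticommutator. A bond inside the string collects two signs, which cancel, and a bond to the right
  of \<open>l\<close> meets only identities.\<close>

lemma bond_commutator_jw:
  assumes j: "1 \<le> j" "j < n" and l: "1 \<le> l" "l \<le> n"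
    and w: "w \<in> carrier_mat 2 2" and x: "x \<in> carrier_mat 2 2"
    and comm: "w * x - x * w = \<kappa>1 \<cdot>\<^sub>m pauli_z"
    and anti: "w * x + x * w = \<kappa>2 \<cdot>\<^sub>m 1\<^sub>m 2"
    and wz: "pauli_z * w = (-1) \<cdot>\<^sub>m (w * pauli_z)"
  shows "commutator (embed n j j w * embed n (j + 1) (j + 1) w) (jw n l x) =
    (if j = l then \<kappa>1 \<cdot>\<^sub>m jw n (j + 1) w
     else if j + 1 = l then \<kappa>2 \<cdot>\<^sub>m jw n j (w * pauli_z)
     else 0\<^sub>m (2 ^ n) (2 ^ n))"
proof -
  let ?f = "\<lambda>i. if i = j \<or> i = j + 1 then w else 1\<^sub>m 2"
  let ?g = "\<lambda>i. if i < l then pauli_z else if i = l then x else 1\<^sub>m 2"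
  let ?C = "commutator (embed n j j w * embed n (j + 1) (j + 1) w) (jw n l x)"
  have c: "?C = site_prod n (\<lambda>i. ?f i * ?g i) - site_prod n (\<lambda>i. ?g i * ?f i)"
    unfolding commutator_def bond_eq_site_prod[OF j w] jw_def
    using w x by (subst (1 2) site_prod_mult) auto
  note m = mult_carrier_mat[OF w x] mult_carrier_mat[OF x w] mult_carrier_mat[OF w pauli_carrier(3)]
  consider "j = l" | "j + 1 = l" | "l < j" | "j + 1 < l" by linarith
  then show ?thesis
  proof cases
    case 1
    let ?h = "\<lambda>i. if i < j then pauli_z else if i = j + 1 then w else 1\<^sub>m 2"
    have "site_prod n (\<lambda>i. ?f i * ?g i) = site_prod n (?h(j := w * x))"
      "site_prod n (\<lambda>i. ?g i * ?f i) = site_prod n (?h(j := x * w))"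
      using 1 w by (auto intro!: site_prod_cong)
    then have "?C = site_prod n (?h(j := w * x - x * w))"
      unfolding c using j w m by (simp only:) (intro site_prod_diff, auto)
    also have "\<dots> = \<kappa>1 \<cdot>\<^sub>m site_prod n (?h(j := pauli_z))"
      unfolding comm using j by (intro site_prod_smult) auto
    also have "site_prod n (?h(j := pauli_z)) = jw n (j + 1) w"
      unfolding jw_def by (rule site_prod_cong) auto
    finally show ?thesis using 1 by simp
  next
    case 2
    let ?h = "\<lambda>i. if i < j then pauli_z else if i = j then w * pauli_z else 1\<^sub>m 2"
    have h: "?h i \<in> carrier_mat 2 2" for i using m by auto
    have "site_prod n (\<lambda>i. ?f i * ?g i) = site_prod n (?h(j + 1 := w * x))"
      using 2 w by (auto intro!: site_prod_cong)
    moreover have "site_prod n (\<lambda>i. ?g i * ?f i) = site_prod n ((?h(j + 1 := x * w))(j := (-1) \<cdot>\<^sub>m (w * pauli_z)))"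
      using 2 w wz by (auto intro!: site_prod_cong)
    moreover have "\<dots> = (-1) \<cdot>\<^sub>m site_prod n ((?h(j + 1 := x * w))(j := w * pauli_z))"
      using j by (intro site_prod_smult) auto
    moreover have "site_prod n ((?h(j + 1 := x * w))(j := w * pauli_z)) = site_prod n (?h(j + 1 := x * w))"
      by (rule site_prod_cong) auto
    moreover have "site_prod n (?h(j + 1 := x * w)) \<in> carrier_mat (2 ^ n) (2 ^ n)"
      "site_prod n (?h(j + 1 := w * x)) \<in> carrier_mat (2 ^ n) (2 ^ n)"
      using h m by (auto intro!: site_prod_carrier)
    ultimately have "?C = site_prod n (?h(j + 1 := w * x)) + site_prod n (?h(j + 1 := x * w))"
      unfolding c by (intro eq_matI) auto
    also have "\<dots> = site_prod n (?h(j + 1 := w * x + x * w))"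
      using h m j by (intro site_prod_add[symmetric]) auto
    also have "\<dots> = \<kappa>2 \<cdot>\<^sub>m site_prod n (?h(j + 1 := 1\<^sub>m 2))"
      unfolding anti using j by (intro site_prod_smult) auto
    also have "site_prod n (?h(j + 1 := 1\<^sub>m 2)) = jw n j (w * pauli_z)"
      unfolding jw_def by (rule site_prod_cong) auto
    finally show ?thesis using 2 by simp
  next
    case 3
    then have "site_prod n (\<lambda>i. ?f i * ?g i) = site_prod n (\<lambda>i. ?g i * ?f i)"
      using w x by (intro site_prod_cong) auto
    moreover have "site_prod n (\<lambda>i. ?g i * ?f i) \<in> carrier_mat (2 ^ n) (2 ^ n)"
      using w x by (intro site_prod_carrier mult_carrier_mat[of _ 2 2]) auto
    ultimately show ?thesis using 3 unfolding c by auto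
  next
    case 4
    let ?h = "\<lambda>i. ?f i * ?g i"
    have "site_prod n (\<lambda>i. ?g i * ?f i) =
        site_prod n ((?h(j := (-1) \<cdot>\<^sub>m (w * pauli_z)))(j + 1 := (-1) \<cdot>\<^sub>m (w * pauli_z)))"
      using 4 w x wz by (intro site_prod_cong) auto
    also have "\<dots> = (-1) \<cdot>\<^sub>m site_prod n ((?h(j := (-1) \<cdot>\<^sub>m (w * pauli_z)))(j + 1 := w * pauli_z))"
      using j by (intro site_prod_smult) auto
    also have "site_prod n ((?h(j := (-1) \<cdot>\<^sub>m (w * pauli_z)))(j + 1 := w * pauli_z)) =
        site_prod n ((?h(j + 1 := w * pauli_z))(j := (-1) \<cdot>\<^sub>m (w * pauli_z)))"
      by (rule site_prod_cong) auto
    also have "\<dots> = (-1) \<cdot>\<^sub>m site_prod n ((?h(j + 1 := w * pauli_z))(j := w * pauli_z))"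
      using j by (intro site_prod_smult) auto
    also have "site_prod n ((?h(j + 1 := w * pauli_z))(j := w * pauli_z)) = site_prod n ?h"
      using 4 by (intro site_prod_cong) auto
    also have "(-1) \<cdot>\<^sub>m ((-1) \<cdot>\<^sub>m site_prod n ?h) = site_prod n ?h"
      by (intro eq_matI) auto
    finally have "site_prod n (\<lambda>i. ?f i * ?g i) = site_prod n (\<lambda>i. ?g i * ?f i)" by simp
    moreover have "site_prod n (\<lambda>i. ?g i * ?f i) \<in> carrier_mat (2 ^ n) (2 ^ n)"
      using w x by (intro site_prod_carrier mult_carrier_mat[of _ 2 2]) auto
    ultimately show ?thesis using 4 unfolding c by auto
  qed
qed

lemma commutator_sum_mat:
  assumes "\<And>i. i \<in> I \<Longrightarrow> f i \<in> carrier_mat d d" "X \<in> carrier_mat d d"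
  shows "commutator (sum_mat d f I) X = sum_mat d (\<lambda>i. commutator (f i) X) I"
proof (rule eq_matI)
  fix a b assume "a < dim_row (sum_mat d (\<lambda>i. commutator (f i) X) I)" "b < dim_col (sum_mat d (\<lambda>i. commutator (f i) X) I)"
  then have ab: "a < d" "b < d" by (auto simp: sum_mat_def)
  have "(sum_mat d f I * X) $$ (a, b) = (\<Sum>i\<in>I. (f i * X) $$ (a, b))"
  proof -
    have "(sum_mat d f I * X) $$ (a, b) = (\<Sum>l<d. \<Sum>i\<in>I. f i $$ (a, l) * X $$ (l, b))"
      unfolding mat_mult_index[OF sum_mat_carrier assms(2) ab] using ab by (simp add: sum_distrib_right)
    also have "\<dots> = (\<Sum>i\<in>I. \<Sum>l<d. f i $$ (a, l) * X $$ (l, b))" by (rule sum.swap)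
    finally show ?thesis using mat_mult_index[OF assms ab] by simp
  qed
  moreover have "(X * sum_mat d f I) $$ (a, b) = (\<Sum>i\<in>I. (X * f i) $$ (a, b))"
  proof -
    have "(X * sum_mat d f I) $$ (a, b) = (\<Sum>l<d. \<Sum>i\<in>I. X $$ (a, l) * f i $$ (l, b))"
      unfolding mat_mult_index[OF assms(2) sum_mat_carrier ab] using ab by (simp add: sum_distrib_left)
    also have "\<dots> = (\<Sum>i\<in>I. \<Sum>l<d. X $$ (a, l) * f i $$ (l, b))" by (rule sum.swap)
    finally show ?thesis using mat_mult_index[OF assms(2,1) ab] by simp
  qed
  moreover have "X * sum_mat d f I \<in> carrier_mat d d" using assms(2) by auto
  moreover have "commutator (f i) X $$ (a, b) = (f i * X) $$ (a, b) - (X * f i) $$ (a, b)" if "i \<in> I" for i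
    using assms(1)[OF that] assms(2) ab unfolding commutator_def by (intro index_minus_mat) auto
  moreover have "commutator (sum_mat d f I) X $$ (a, b) = (sum_mat d f I * X) $$ (a, b) - (X * sum_mat d f I) $$ (a, b)"
    using assms(2) ab unfolding commutator_def by (intro index_minus_mat) (auto simp: sum_mat_def)
  ultimately show "commutator (sum_mat d f I) X $$ (a, b) = sum_mat d (\<lambda>i. commutator (f i) X) I $$ (a, b)"
    using ab by (simp add: sum_subtractf)
qed (use assms in \<open>auto simp: commutator_def sum_mat_def\<close>)

section \<open>The xy Hamiltonian and its bonds\<close>

context
  fixes \<mu> \<gamma> \<nu> :: "nat \<Rightarrow> real" and n :: nat
begin

definition bond :: "nat \<Rightarrow> complex mat" where
  "bond j = complex_of_real (\<mu> j) \<cdot>\<^sub>m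
    (complex_of_real (1 + \<gamma> j) \<cdot>\<^sub>m (embed n j j pauli_x * embed n (j + 1) (j + 1) pauli_x) +
     complex_of_real (1 - \<gamma> j) \<cdot>\<^sub>m (embed n j j pauli_y * embed n (j + 1) (j + 1) pauli_y))"

lemma xy_hamiltonian_eq:
  "xy_hamiltonian \<mu> \<gamma> \<nu> n = sum_mat (2 ^ n) bond {1..<n} +
    sum_mat (2 ^ n) (\<lambda>j. complex_of_real (\<nu> j) \<cdot>\<^sub>m embed n j j pauli_z) {1..n}"
  unfolding xy_hamiltonian_def by (simp only: bond_def[abs_def])

lemma xy_hamiltonian_carrier: "xy_hamiltonian \<mu> \<gamma> \<nu> n \<in> carrier_mat (2 ^ n) (2 ^ n)"
  unfolding xy_hamiltonian_eq by (intro add_carrier_mat) simp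

lemma bond_carrier:
  assumes "1 \<le> j" "j < n"
  shows "bond j \<in> carrier_mat (2 ^ n) (2 ^ n)"
  unfolding bond_def using assms
  by (intro smult_carrier_mat add_carrier_mat mult_carrier_mat[of _ "2 ^ n" "2 ^ n"] embed_carrier) auto

lemma adj_bond:
  assumes "1 \<le> j" "j < n"
  shows "adj (bond j) = bond j"
proof -
  have "adj (embed n j j w * embed n (j + 1) (j + 1) w) = embed n j j w * embed n (j + 1) (j + 1) w"
    if "w \<in> carrier_mat 2 2" "adj w = w" for w
    unfolding bond_eq_site_prod[OF assms that(1)] adj_site_prod using that adj_pauli(5) by (intro site_prod_cong) (simp only: split: if_split, simp)
  note * = this[of pauli_x, simplified] this[of pauli_y, simplified]
  have c: "embed n j j w * embed n (j + 1) (j + 1) w \<in> carrier_mat (2 ^ n) (2 ^ n)" if "w \<in> carrier_mat 2 2" for w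
    using that assms by (intro mult_carrier_mat[of _ "2 ^ n" "2 ^ n"] embed_carrier) auto
  have "adj (p \<cdot>\<^sub>m (q \<cdot>\<^sub>m X + r \<cdot>\<^sub>m Y)) = cnj p \<cdot>\<^sub>m (cnj q \<cdot>\<^sub>m adj X + cnj r \<cdot>\<^sub>m adj Y)"
    if "X \<in> carrier_mat d d" "Y \<in> carrier_mat d d" for p q r X Y d
    using that by (intro eq_matI) auto
  from this[OF c c, OF pauli_carrier(1,2)] show ?thesis
    unfolding bond_def by (simp add: *)
qed

lemma adj_xy_hamiltonian: "adj (xy_hamiltonian \<mu> \<gamma> \<nu> n) = xy_hamiltonian \<mu> \<gamma> \<nu> n"
proof (rule eq_matI)
  fix a b assume "a < dim_row (xy_hamiltonian \<mu> \<gamma> \<nu> n)" "b < dim_col (xy_hamiltonian \<mu> \<gamma> \<nu> n)"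
  then have ab: "a < 2 ^ n" "b < 2 ^ n" using xy_hamiltonian_carrier by auto
  have 1: "cnj (bond j $$ (b, a)) = bond j $$ (a, b)" if "j \<in> {1..<n}" for j
    using arg_cong[OF adj_bond, of j "\<lambda>A. A $$ (a, b)"] bond_carrier[of j] that ab by simp
  have 2: "cnj ((complex_of_real (\<nu> j) \<cdot>\<^sub>m embed n j j pauli_z) $$ (b, a)) =
      (complex_of_real (\<nu> j) \<cdot>\<^sub>m embed n j j pauli_z) $$ (a, b)" if "j \<in> {1..n}" for j
  proof -
    have "adj (embed n j j pauli_z) = embed n j j pauli_z"
      using that adj_pauli(3,5) by (simp only: embed_eq_site_prod adj_site_prod if_distrib[of adj] atLeastAtMost_iff)
    from arg_cong[OF this, of "\<lambda>A. A $$ (a, b)"] show ?thesis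
      using embed_carrier[OF pauli_carrier(3), of j n] that ab by simp
  qed
  show "adj (xy_hamiltonian \<mu> \<gamma> \<nu> n) $$ (a, b) = xy_hamiltonian \<mu> \<gamma> \<nu> n $$ (a, b)"
    using ab 1 2 carrier_matD[OF xy_hamiltonian_carrier] unfolding xy_hamiltonian_eq
    by (simp add: sum_mat_def)
qed (use carrier_matD[OF xy_hamiltonian_carrier] in auto)

end

lemma sum_lessThan_add:
  fixes f :: "nat \<Rightarrow> 'a::comm_monoid_add"
  shows "(\<Sum>i<n + m. f i) = (\<Sum>i<n. f i) + (\<Sum>i<m. f (n + i))"
  by (induction m) (auto simp: add.assoc)

lemma op_norm_zero: "op_norm (0\<^sub>m n m) \<le> 0"
proof (rule op_norm_leI)
  fix v :: "complex vec" assume "v \<in> carrier_vec (dim_col (0\<^sub>m n m :: complex mat))"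
  then have "0\<^sub>m n m *\<^sub>v v = 0\<^sub>v n" by (intro eq_vecI) auto
  then show "l2_norm (0\<^sub>m n m *\<^sub>v v) \<le> 0" by simp
qed

lemma op_norm_sum_mat:
  assumes "finite I" "\<And>i. i \<in> I \<Longrightarrow> f i \<in> carrier_mat d d"
  shows "op_norm (sum_mat d f I) \<le> (\<Sum>i\<in>I. op_norm (f i))"
  using assms
proof (induction I rule: finite_induct)
  case empty
  have "sum_mat d f {} = 0\<^sub>m d d" by (rule eq_matI) (auto simp: sum_mat_def)
  then show ?case using op_norm_zero by simp
next
  case (insert i I)
  have "sum_mat d f (insert i I) = f i + sum_mat d f I"
    using insert carrier_matD[OF insert.prems[of i]] by (intro eq_matI) (auto simp: sum_mat_def)
  moreover have "op_norm (f i + sum_mat d f I) \<le> op_norm (f i) + op_norm (sum_mat d f I)"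
    using insert by (intro op_norm_add[of _ d d]) auto
  ultimately show ?case using insert by force
qed

lemma adj_sum_mat:
  assumes "\<And>i. i \<in> I \<Longrightarrow> f i \<in> carrier_mat d d"
  shows "adj (sum_mat d f I) = sum_mat d (\<lambda>i. adj (f i)) I"
proof (rule eq_matI)
  fix a b assume "a < dim_row (sum_mat d (\<lambda>i. adj (f i)) I)" "b < dim_col (sum_mat d (\<lambda>i. adj (f i)) I)"
  then have "a < d" "b < d" by (auto simp: sum_mat_def)
  then show "adj (sum_mat d f I) $$ (a, b) = sum_mat d (\<lambda>i. adj (f i)) I $$ (a, b)"
    using carrier_matD[OF assms] by (auto simp: sum_mat_def intro!: sum.cong)
qed (auto simp: sum_mat_def)

section \<open>Commutators of ladder operators with the right-hand observable\<close>

lemma commutator_jw_local_algebra: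
  assumes "x \<in> carrier_mat 2 2" "m < k" "1 \<le> k" "k \<le> n" and B: "B \<in> local_algebra n k n"
  shows "commutator (jw n m x) B = 0\<^sub>m (2 ^ n) (2 ^ n)"
proof -
  have "jw n m x * B = B * jw n m x"
    unfolding jw_def using assms by (intro site_prod_commute_local_algebra[OF _ _ _ _ B]) auto
  moreover have "B * jw n m x \<in> carrier_mat (2 ^ n) (2 ^ n)"
    by (rule mult_carrier_mat[OF local_algebra_carrier[OF B assms(3,4)] jw_carrier[OF assms(1)]])
  ultimately show ?thesis by (auto simp: commutator_def)
qed

lemma op_norm_commutator_sum_ladder:
  assumes k: "1 \<le> k" "k \<le> n" and B: "B \<in> local_algebra n k n"
  shows "op_norm (commutator (sum_mat (2 ^ n) (\<lambda>m. \<alpha> m \<cdot>\<^sub>m jw n m (ladder s)) {1..n}) B) \<le>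
    2 * op_norm B * (\<Sum>m = k..n. cmod (\<alpha> m))"
proof -
  let ?d = "2 ^ n :: nat"
  note Bc = local_algebra_carrier[OF B k]
  note c = jw_carrier[OF pauli_carrier(4), of n _ s]
  have "op_norm (commutator (sum_mat ?d (\<lambda>m. \<alpha> m \<cdot>\<^sub>m jw n m (ladder s)) {1..n}) B) \<le>
      (\<Sum>m = 1..n. op_norm (commutator (\<alpha> m \<cdot>\<^sub>m jw n m (ladder s)) B))"
    using c Bc by (subst commutator_sum_mat) (auto intro!: op_norm_sum_mat commutator_carrier)
  also have "\<dots> \<le> (\<Sum>m = 1..n. if m \<in> {k..n} then 2 * op_norm B * cmod (\<alpha> m) else 0)"
  proof (rule sum_mono)
    fix m assume m: "m \<in> {1..n}"
    have "op_norm (commutator (\<alpha> m \<cdot>\<^sub>m jw n m (ladder s)) B) \<le> cmod (\<alpha> m) * op_norm (commutator (jw n m (ladder s)) B)"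
      by (rule op_norm_commutator_smult[OF c Bc])
    also have "\<dots> \<le> cmod (\<alpha> m) * (if k \<le> m then 2 * op_norm B else 0)"
    proof (intro mult_left_mono norm_ge_zero)
      have "op_norm (commutator (jw n m (ladder s)) B) \<le> 2 * op_norm (jw n m (ladder s)) * op_norm B"
        by (rule op_norm_commutator_le[OF c Bc])
      also have "\<dots> \<le> 2 * 1 * op_norm B"
        using m by (intro mult_mono op_norm_jw_ladder) auto
      finally show "op_norm (commutator (jw n m (ladder s)) B) \<le> (if k \<le> m then 2 * op_norm B else 0)"
        using commutator_jw_local_algebra[OF pauli_carrier(4) _ k B, of m s] op_norm_zero by auto
    qed
    finally show "op_norm (commutator (\<alpha> m \<cdot>\<^sub>m jw n m (ladder s)) B) \<le>
        (if m \<in> {k..n} then 2 * op_norm B * cmod (\<alpha> m) else 0)"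
      using m by (simp add: mult_ac split: if_splits)
  qed
  also have "\<dots> = 2 * op_norm B * (\<Sum>m = k..n. cmod (\<alpha> m))"
    using k by (subst sum.inter_restrict[symmetric]) (auto simp: sum_distrib_left Int_absorb1 intro!: sum.cong)
  finally show ?thesis .
qed

context
  fixes \<mu> \<gamma> \<nu> :: "nat \<Rightarrow> real" and n :: nat
begin

text \<open>The bonds in \<open>pauli_x\<close> and \<open>pauli_y\<close> contribute the sum and
  the difference of the two ladder operators, with these roles exchanged between the two directions.
  Weighted by \<open>1 + \<gamma> j\<close> and \<open>1 - \<gamma> j\<close> they leave 2 for the
  operator of the same kind and plus or minus \<open>2 * \<gamma> j\<close> for the opposite kind.
  The equal signs make the block \<open>A\<close> symmetric, the changing sign makes
  \<open>B\<close> antisymmetric.\<close>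

lemma bond_commutator_ladder:
  assumes j: "1 \<le> j" "j < n" and l: "1 \<le> l" "l \<le> n" and ab: "a < 2 ^ n" "b < 2 ^ n"
  shows "commutator (bond \<mu> \<gamma> n j) (jw n l (ladder s)) $$ (a, b) =
    (if j = l then 2 * sg s * \<mu> j * (jw n (j + 1) (ladder s) $$ (a, b) + \<gamma> j * jw n (j + 1) (ladder (\<not> s)) $$ (a, b)) else 0) +
    (if j + 1 = l then 2 * sg s * \<mu> j * (jw n j (ladder s) $$ (a, b) - \<gamma> j * jw n j (ladder (\<not> s)) $$ (a, b)) else 0)"
proof -
  let ?b = "\<lambda>w. embed n j j w * embed n (j + 1) (j + 1) w"
  let ?c = "jw n l (ladder s)"
  have bc: "?b w \<in> carrier_mat (2 ^ n) (2 ^ n)" if "w \<in> carrier_mat 2 2" for w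
    using that j by (intro mult_carrier_mat[of _ "2 ^ n" "2 ^ n"] embed_carrier) auto
  note bx = bc[OF pauli_carrier(1)] and b_y = bc[OF pauli_carrier(2)]
  note c = jw_carrier[OF pauli_carrier(4)]
  have com: "commutator (bond \<mu> \<gamma> n j) ?c = complex_of_real (\<mu> j) \<cdot>\<^sub>m
      (complex_of_real (1 + \<gamma> j) \<cdot>\<^sub>m commutator (?b pauli_x) ?c + complex_of_real (1 - \<gamma> j) \<cdot>\<^sub>m commutator (?b pauli_y) ?c)"
    unfolding bond_def
    by (simp only: commutator_smult[OF add_carrier_mat[OF smult_carrier_mat[OF b_y]] c]
      commutator_add[OF smult_carrier_mat[OF bx] smult_carrier_mat[OF b_y] c]
      commutator_smult[OF bx c] commutator_smult[OF b_y c])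
  have d: "dim_row (commutator (?b w) ?c) = 2 ^ n" "dim_col (commutator (?b w) ?c) = 2 ^ n" if "w \<in> carrier_mat 2 2" for w
    using commutator_carrier[OF bc[OF that] c] by auto
  note d = d[OF pauli_carrier(1)] d[OF pauli_carrier(2)]
  have idx: "commutator (bond \<mu> \<gamma> n j) ?c $$ (a, b) = \<mu> j * ((1 + \<gamma> j) * commutator (?b pauli_x) ?c $$ (a, b) +
      (1 - \<gamma> j) * commutator (?b pauli_y) ?c $$ (a, b))"
    unfolding com using d ab by simp
  let ?A = "\<lambda>i. jw n i (ladder s) $$ (a, b)" and ?B = "\<lambda>i. jw n i (ladder (\<not> s)) $$ (a, b)"
  have jwx: "jw n i pauli_x $$ (a, b) = ?A i + ?B i"
    and jwy: "jw n i pauli_y $$ (a, b) = \<i> * sg s * ?A i + - \<i> * sg s * ?B i"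
    and jwxz: "jw n i (pauli_x * pauli_z) $$ (a, b) = sg s * ?A i + - sg s * ?B i"
    and jwyz: "jw n i (pauli_y * pauli_z) $$ (a, b) = \<i> * ?A i + \<i> * ?B i"
    if "1 \<le> i" "i \<le> n" for i
    unfolding pauli_eq_ladder(3,4)[of s] unfolding pauli_eq_ladder(1,2)[of s] using ab carrier_matD[OF c]
    by (simp_all only: jw_add[OF smult_carrier_mat smult_carrier_mat that] jw_add[OF _ _ that] pauli_carrier
      jw_smult[OF that] index_add_mat index_smult_mat)
  note X = bond_commutator_jw[OF j l pauli_carrier(1) pauli_carrier(4) pauli_x_ladder_comm pauli_x_ladder_anticomm pauli_z_pauli_x]
    and Y = bond_commutator_jw[OF j l pauli_carrier(2) pauli_carrier(4) pauli_y_ladder_comm pauli_y_ladder_anticomm pauli_z_pauli_y]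
  have dim: "dim_row (jw n i w) = 2 ^ n" "dim_col (jw n i w) = 2 ^ n" if "w \<in> carrier_mat 2 2" for i w
    using jw_carrier[OF that] by auto
  note dim = dim[OF pauli_carrier(1)] dim[OF pauli_carrier(2)]
    dim[OF mult_carrier_mat[OF pauli_carrier(1) pauli_carrier(3)]]
    dim[OF mult_carrier_mat[OF pauli_carrier(2) pauli_carrier(3)]]
  consider "j = l" | "j + 1 = l" "j \<noteq> l" | "j \<noteq> l" "j + 1 \<noteq> l" by blast
  then show ?thesis
  proof cases
    case 1
    have "commutator (?b pauli_x) ?c $$ (a, b) = sg s * (?A (j + 1) + ?B (j + 1))"
      unfolding X[unfolded if_P[OF 1]] using ab dim jwx[of "j + 1"] j by simp
    moreover have "commutator (?b pauli_y) ?c $$ (a, b) = sg s * (?A (j + 1) - ?B (j + 1))"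
    proof -
      have "commutator (?b pauli_y) ?c $$ (a, b) = - \<i> * jw n (j + 1) pauli_y $$ (a, b)"
        unfolding Y[unfolded if_P[OF 1]] using ab dim by (simp only: index_smult_mat)
      also have "\<dots> = sg s * (?A (j + 1) - ?B (j + 1))"
        by (subst jwy) (use j in \<open>auto simp: algebra_simps\<close>)
      finally show ?thesis .
    qed
    ultimately have *: "commutator (bond \<mu> \<gamma> n j) ?c $$ (a, b) =
        \<mu> j * ((1 + \<gamma> j) * (sg s * (?A (j + 1) + ?B (j + 1))) + (1 - \<gamma> j) * (sg s * (?A (j + 1) - ?B (j + 1))))"
      unfolding idx by (simp only:)
    have "j + 1 \<noteq> l" using 1 by simp
    then show ?thesis
      unfolding * if_P[OF 1] by (simp add: algebra_simps)
  next
    case 2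
    have "commutator (?b pauli_x) ?c $$ (a, b) = sg s * (?A j - ?B j)"
    proof -
      have "commutator (?b pauli_x) ?c $$ (a, b) = 1 * jw n j (pauli_x * pauli_z) $$ (a, b)"
        unfolding X[unfolded if_not_P[OF 2(2)] if_P[OF 2(1)]] using ab dim by (simp only: index_smult_mat)
      also have "\<dots> = sg s * (?A j - ?B j)"
        by (subst jwxz) (use j in \<open>auto simp: algebra_simps\<close>)
      finally show ?thesis .
    qed
    moreover have "commutator (?b pauli_y) ?c $$ (a, b) = sg s * (?A j + ?B j)"
    proof -
      have "commutator (?b pauli_y) ?c $$ (a, b) = (- sg s * \<i>) * jw n j (pauli_y * pauli_z) $$ (a, b)"
        unfolding Y[unfolded if_not_P[OF 2(2)] if_P[OF 2(1)]] using ab dim by (simp only: index_smult_mat)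
      also have "\<dots> = sg s * (?A j + ?B j)"
        by (subst jwyz) (use j in \<open>auto simp: algebra_simps\<close>)
      finally show ?thesis .
    qed
    ultimately have *: "commutator (bond \<mu> \<gamma> n j) ?c $$ (a, b) =
        \<mu> j * ((1 + \<gamma> j) * (sg s * (?A j - ?B j)) + (1 - \<gamma> j) * (sg s * (?A j + ?B j)))"
      unfolding idx by (simp only:)
    show ?thesis
      unfolding * if_not_P[OF 2(2)] if_P[OF 2(1)] by (simp add: algebra_simps)
  next
    case 3
    then show ?thesis unfolding idx X Y using ab by simp
  qed
qed


end

text \<open>The column of all \<open>c\<^sub>j\<close> followed by all their adjoints, numbered from
  0, in the order of the blocks of \<open>one_particle\<close>.\<close>

definition modes :: "nat \<Rightarrow> nat \<Rightarrow> complex mat" where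
  "modes n k = (if k < n then jw n (k + 1) (ladder True) else jw n (k - n + 1) (ladder False))"

lemma modes_carrier: "modes n k \<in> carrier_mat (2 ^ n) (2 ^ n)"
  by (auto simp: modes_def intro: jw_carrier)

context
  fixes \<mu> \<gamma> \<nu> :: "nat \<Rightarrow> real" and n :: nat
begin

lemma block_A_sum:
  fixes f :: "nat \<Rightarrow> complex"
  assumes "k < n"
  shows "(\<Sum>l<n. complex_of_real (block_A \<mu> \<nu> n $$ (k, l)) * f l) =
    \<nu> (k + 1) * f k + (if k + 1 < n then - \<mu> (k + 1) * f (k + 1) else 0) + (if 1 \<le> k then - \<mu> k * f (k - 1) else 0)"
proof -
  \<comment> \<open>At \<open>k = 0\<close> the truncated difference \<open>k - 1\<close> is 0 and
    would select the diagonal entry; the inner guard \<open>1 \<le> k\<close> removes that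
    term.\<close>
  have "(\<Sum>l<n. complex_of_real (block_A \<mu> \<nu> n $$ (k, l)) * f l) =
    (\<Sum>l<n. (if l = k then \<nu> (k + 1) * f k else 0) + (if l = k + 1 then - \<mu> (k + 1) * f (k + 1) else 0)
      + (if l = k - 1 then (if 1 \<le> k then - \<mu> k * f (k - 1) else 0) else 0))"
    using assms by (intro sum.cong refl) (auto simp: block_A_def)
  also have "\<dots> = \<nu> (k + 1) * f k + (if k + 1 < n then - \<mu> (k + 1) * f (k + 1) else 0) + (if 1 \<le> k then - \<mu> k * f (k - 1) else 0)"
    unfolding sum.distrib using assms by (simp only: sum.delta finite_lessThan lessThan_iff) auto
  finally show ?thesis .
qed

lemma block_B_sum:
  fixes f :: "nat \<Rightarrow> complex"
  assumes "k < n"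
  shows "(\<Sum>l<n. complex_of_real (block_B \<mu> \<gamma> n $$ (k, l)) * f l) =
    (if k + 1 < n then - \<mu> (k + 1) * \<gamma> (k + 1) * f (k + 1) else 0) + (if 1 \<le> k then \<mu> k * \<gamma> k * f (k - 1) else 0)"
proof -
  have "(\<Sum>l<n. complex_of_real (block_B \<mu> \<gamma> n $$ (k, l)) * f l) =
    (\<Sum>l<n. (if l = k + 1 then - \<mu> (k + 1) * \<gamma> (k + 1) * f (k + 1) else 0)
      + (if l = k - 1 then (if 1 \<le> k then \<mu> k * \<gamma> k * f (k - 1) else 0) else 0))"
    using assms by (intro sum.cong refl) (auto simp: block_B_def)
  also have "\<dots> = (if k + 1 < n then - \<mu> (k + 1) * \<gamma> (k + 1) * f (k + 1) else 0) + (if 1 \<le> k then \<mu> k * \<gamma> k * f (k - 1) else 0)"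
    unfolding sum.distrib using assms by (simp only: sum.delta finite_lessThan lessThan_iff) auto
  finally show ?thesis .
qed

lemma hamiltonian_commutator_ladder:
  assumes k: "k < n" and ab: "a < 2 ^ n" "b < 2 ^ n"
  shows "commutator (xy_hamiltonian \<mu> \<gamma> \<nu> n) (jw n (k + 1) (ladder s)) $$ (a, b) =
    - 2 * sg s * ((\<Sum>l<n. complex_of_real (block_A \<mu> \<nu> n $$ (k, l)) * jw n (l + 1) (ladder s) $$ (a, b)) +
      (\<Sum>l<n. complex_of_real (block_B \<mu> \<gamma> n $$ (k, l)) * jw n (l + 1) (ladder (\<not> s)) $$ (a, b)))"
proof -
  let ?c = "jw n (k + 1) (ladder s)"
  note c = jw_carrier[OF pauli_carrier(4)]
  let ?cs = "\<lambda>m. jw n m (ladder s) $$ (a, b)" and ?cn = "\<lambda>m. jw n m (ladder (\<not> s)) $$ (a, b)"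
  have ec: "embed n j j pauli_z \<in> carrier_mat (2 ^ n) (2 ^ n)" if "j \<in> {1..n}" for j
    using that by (auto intro: embed_carrier)
  have "commutator (xy_hamiltonian \<mu> \<gamma> \<nu> n) ?c =
      commutator (sum_mat (2 ^ n) (bond \<mu> \<gamma> n) {1..<n}) ?c +
      commutator (sum_mat (2 ^ n) (\<lambda>j. complex_of_real (\<nu> j) \<cdot>\<^sub>m embed n j j pauli_z) {1..n}) ?c"
    unfolding xy_hamiltonian_eq by (rule commutator_add[OF sum_mat_carrier sum_mat_carrier c])
  also have "\<dots> = sum_mat (2 ^ n) (\<lambda>j. commutator (bond \<mu> \<gamma> n j) ?c) {1..<n} +
      sum_mat (2 ^ n) (\<lambda>j. commutator (complex_of_real (\<nu> j) \<cdot>\<^sub>m embed n j j pauli_z) ?c) {1..n}"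
    using ec by (intro arg_cong2[of _ _ _ _ "(+)"] commutator_sum_mat c) (auto intro: bond_carrier)
  finally have "commutator (xy_hamiltonian \<mu> \<gamma> \<nu> n) ?c $$ (a, b) =
      (\<Sum>j = 1..<n. commutator (bond \<mu> \<gamma> n j) ?c $$ (a, b)) +
      (\<Sum>j = 1..n. commutator (complex_of_real (\<nu> j) \<cdot>\<^sub>m embed n j j pauli_z) ?c $$ (a, b))"
    using ab by (simp add: sum_mat_def)
  also have "(\<Sum>j = 1..n. commutator (complex_of_real (\<nu> j) \<cdot>\<^sub>m embed n j j pauli_z) ?c $$ (a, b)) =
      (\<Sum>j = 1..n. if j = k + 1 then - 2 * sg s * \<nu> (k + 1) * ?cs (k + 1) else 0)"
  proof (intro sum.cong refl)
    fix j assume j: "j \<in> {1..n}"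
    then show "commutator (complex_of_real (\<nu> j) \<cdot>\<^sub>m embed n j j pauli_z) ?c $$ (a, b) =
        (if j = k + 1 then - 2 * sg s * \<nu> (k + 1) * ?cs (k + 1) else 0)"
      unfolding commutator_smult[OF ec[OF j] c] using k ab carrier_matD[OF c]
      by (subst site_commutator_jw) auto
  qed
  also have "\<dots> = - 2 * sg s * \<nu> (k + 1) * ?cs (k + 1)"
    using k by (simp only: sum.delta finite_atLeastAtMost) auto
  \<comment> \<open>Row \<open>k\<close>, numbered from 0, belongs to site \<open>k + 1\<close>, so
    the bonds that meet it are \<open>k\<close> and \<open>k + 1\<close>, as far as they lie in the
    chain.\<close>
  also have "(\<Sum>j = 1..<n. commutator (bond \<mu> \<gamma> n j) ?c $$ (a, b)) =
      (\<Sum>j = 1..<n. (if j = k + 1 then 2 * sg s * \<mu> (k + 1) * (?cs (k + 2) + \<gamma> (k + 1) * ?cn (k + 2)) else 0) +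
        (if j = k then 2 * sg s * \<mu> k * (?cs k - \<gamma> k * ?cn k) else 0))"
    using k ab by (intro sum.cong refl) (subst bond_commutator_ladder, auto)
  also have "\<dots> = (if k + 1 < n then 2 * sg s * \<mu> (k + 1) * (?cs (k + 2) + \<gamma> (k + 1) * ?cn (k + 2)) else 0) +
        (if 1 \<le> k then 2 * sg s * \<mu> k * (?cs k - \<gamma> k * ?cn k) else 0)"
    unfolding sum.distrib using k by (simp only: sum.delta finite_atLeastLessThan) auto
  finally show ?thesis
    unfolding block_A_sum[OF k] block_B_sum[OF k] by (auto simp: algebra_simps eq_neg_iff_add_eq_0)
qed

lemma one_particle_index:
  assumes "k < n" "l < n"
  shows "one_particle \<mu> \<gamma> \<nu> n $$ (k, l) = block_A \<mu> \<nu> n $$ (k, l)"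
    "one_particle \<mu> \<gamma> \<nu> n $$ (k, n + l) = block_B \<mu> \<gamma> n $$ (k, l)"
    "one_particle \<mu> \<gamma> \<nu> n $$ (n + k, l) = - block_B \<mu> \<gamma> n $$ (k, l)"
    "one_particle \<mu> \<gamma> \<nu> n $$ (n + k, n + l) = - block_A \<mu> \<nu> n $$ (k, l)"
  using assms by (auto simp: one_particle_def block_A_def block_B_def)

lemma one_particle_carrier: "one_particle \<mu> \<gamma> \<nu> n \<in> carrier_mat (2 * n) (2 * n)"
  by (auto simp: one_particle_def block_A_def block_B_def)

lemma one_particle_sum:
  fixes f :: "nat \<Rightarrow> complex"
  assumes "k < n"
  shows "(\<Sum>l<n. complex_of_real (one_particle \<mu> \<gamma> \<nu> n $$ (k, l)) * f l) =
      (\<Sum>l<n. complex_of_real (block_A \<mu> \<nu> n $$ (k, l)) * f l)"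
    "(\<Sum>l<n. complex_of_real (one_particle \<mu> \<gamma> \<nu> n $$ (k, n + l)) * f l) =
      (\<Sum>l<n. complex_of_real (block_B \<mu> \<gamma> n $$ (k, l)) * f l)"
    "(\<Sum>l<n. complex_of_real (one_particle \<mu> \<gamma> \<nu> n $$ (n + k, l)) * f l) =
      - (\<Sum>l<n. complex_of_real (block_B \<mu> \<gamma> n $$ (k, l)) * f l)"
    "(\<Sum>l<n. complex_of_real (one_particle \<mu> \<gamma> \<nu> n $$ (n + k, n + l)) * f l) =
      - (\<Sum>l<n. complex_of_real (block_A \<mu> \<nu> n $$ (k, l)) * f l)"
  unfolding sum_negf[symmetric]
  by (intro sum.cong refl; simp only: lessThan_iff one_particle_index[OF assms] of_real_minus mult_minus_left)+

text \<open>Passing from \<open>c\<^sub>j\<close> to its adjoint flips \<open>sg\<close> and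
  exchanges the two kinds of operators; this is exactly how the lower blocks \<open>- B\<close> and
  \<open>- A\<close> arise from the upper ones.\<close>

lemma hamiltonian_commutator_modes:
  assumes k: "k < 2 * n"
  shows "commutator (xy_hamiltonian \<mu> \<gamma> \<nu> n) (modes n k) =
    sum_mat (2 ^ n) (\<lambda>l. map_mat (\<lambda>r. complex_of_real (- 2 * r)) (one_particle \<mu> \<gamma> \<nu> n) $$ (k, l) \<cdot>\<^sub>m modes n l) {..<2 * n}"
    (is "_ = ?R")
proof (rule eq_matI)
  fix a b assume "a < dim_row ?R" "b < dim_col ?R"
  then have ab: "a < 2 ^ n" "b < 2 ^ n" by (auto simp: sum_mat_def)
  let ?M = "one_particle \<mu> \<gamma> \<nu> n"
  have "?R $$ (a, b) = (\<Sum>l<n + n. - 2 * complex_of_real (?M $$ (k, l)) * modes n l $$ (a, b))"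
    unfolding index_sum_mat[OF ab] mult_2[symmetric]
  proof (intro sum.cong refl)
    fix l assume "l \<in> {..<2 * n}"
    then show "(map_mat (\<lambda>r. complex_of_real (- 2 * r)) ?M $$ (k, l) \<cdot>\<^sub>m modes n l) $$ (a, b) =
        - 2 * complex_of_real (?M $$ (k, l)) * modes n l $$ (a, b)"
      using ab k carrier_matD[OF one_particle_carrier] carrier_matD[OF modes_carrier] by simp
  qed
  also have "\<dots> = (\<Sum>l<n. - 2 * complex_of_real (?M $$ (k, l)) * jw n (l + 1) (ladder True) $$ (a, b)) +
      (\<Sum>l<n. - 2 * complex_of_real (?M $$ (k, n + l)) * jw n (l + 1) (ladder False) $$ (a, b))"
    unfolding sum_lessThan_add by (simp add: modes_def)
  finally have R: "?R $$ (a, b) = - 2 * ((\<Sum>l<n. complex_of_real (?M $$ (k, l)) * jw n (l + 1) (ladder True) $$ (a, b)) +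
      (\<Sum>l<n. complex_of_real (?M $$ (k, n + l)) * jw n (l + 1) (ladder False) $$ (a, b)))"
    by (simp add: distrib_left sum_distrib_left mult.assoc)
  show "commutator (xy_hamiltonian \<mu> \<gamma> \<nu> n) (modes n k) $$ (a, b) = ?R $$ (a, b)"
  proof (cases "k < n")
    case True
    then have m: "modes n k = jw n (k + 1) (ladder True)" by (simp add: modes_def)
    show ?thesis
      unfolding R m hamiltonian_commutator_ladder[OF True ab, of True] one_particle_sum[OF True] by (simp add: sg_def)
  next
    case False
    define k' where "k' = k - n"
    then have k': "k = n + k'" "k' < n" using k False by auto
    then have m: "modes n k = jw n (k' + 1) (ladder False)" by (simp add: modes_def)
    show ?thesis
      unfolding R m hamiltonian_commutator_ladder[OF k'(2) ab, of False] unfolding k'(1)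
unfolding one_particle_sum[OF k'(2)] by (simp add: sg_def)
  qed
qed (simp_all only: carrier_matD[OF commutator_carrier[OF xy_hamiltonian_carrier modes_carrier]] carrier_matD[OF sum_mat_carrier])


lemma heisenberg_ladder:
  fixes t :: real
  assumes j: "1 \<le> j" "j \<le> n"
  defines "p \<equiv> \<lambda>m. propagator_entry (one_particle \<mu> \<gamma> \<nu> n) j m (2 * t)"
  shows "heisenberg (xy_hamiltonian \<mu> \<gamma> \<nu> n) t (jw n j (ladder True)) =
      sum_mat (2 ^ n) (\<lambda>m. p m \<cdot>\<^sub>m jw n m (ladder True)) {1..n} +
      sum_mat (2 ^ n) (\<lambda>m. p (n + m) \<cdot>\<^sub>m jw n m (ladder False)) {1..n}" (is ?T)
    and "heisenberg (xy_hamiltonian \<mu> \<gamma> \<nu> n) t (jw n j (ladder False)) =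
      sum_mat (2 ^ n) (\<lambda>m. cnj (p m) \<cdot>\<^sub>m jw n m (ladder False)) {1..n} +
      sum_mat (2 ^ n) (\<lambda>m. cnj (p (n + m)) \<cdot>\<^sub>m jw n m (ladder True)) {1..n}"
proof -
  let ?H = "xy_hamiltonian \<mu> \<gamma> \<nu> n" and ?M = "one_particle \<mu> \<gamma> \<nu> n" and ?d = "2 ^ n :: nat"
  let ?G = "map_mat (\<lambda>r. complex_of_real (- 2 * r)) ?M"
  have G: "?G \<in> carrier_mat (2 * n) (2 * n)" using one_particle_carrier by simp
  \<comment> \<open>Since \<open>i t\<close> times \<open>- 2 M\<close> is
    \<open>- i (2 t) M\<close>, the chain at time \<open>t\<close> involves the one-particle
    propagator at time \<open>2 t\<close>.\<close>
  have scale: "(\<i> * complex_of_real t) \<cdot>\<^sub>m ?G = (- \<i> * complex_of_real (2 * t)) \<cdot>\<^sub>m map_mat complex_of_real ?M"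
    by (rule eq_matI) auto
  have p: "mat_exp ((\<i> * complex_of_real t) \<cdot>\<^sub>m ?G) $$ (j - 1, l) = p (Suc l)" for l
    unfolding p_def propagator_entry_def scale by (simp only: diff_Suc_1)
  have mode: "modes n (j - 1) = jw n j (ladder True)" using j unfolding modes_def by (subst if_P) auto
  have "heisenberg ?H t (modes n (j - 1)) =
      sum_mat ?d (\<lambda>l. mat_exp ((\<i> * complex_of_real t) \<cdot>\<^sub>m ?G) $$ (j - 1, l) \<cdot>\<^sub>m modes n l) {..<2 * n}"
    using j
    by (intro heisenberg_linear_orbit[OF xy_hamiltonian_carrier adj_xy_hamiltonian G modes_carrier hamiltonian_commutator_modes]) auto
  also have "\<dots> = sum_mat ?d (\<lambda>m. p m \<cdot>\<^sub>m jw n m (ladder True)) {1..n} +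
      sum_mat ?d (\<lambda>m. p (n + m) \<cdot>\<^sub>m jw n m (ladder False)) {1..n}" (is "?L = ?R1 + ?R2")
  proof (rule eq_matI)
    fix a b assume "a < dim_row (?R1 + ?R2)" "b < dim_col (?R1 + ?R2)"
    then have ab: "a < ?d" "b < ?d"
      by (simp_all only: index_add_mat carrier_matD[OF sum_mat_carrier])
    have e: "(x \<cdot>\<^sub>m modes n l) $$ (a, b) = x * modes n l $$ (a, b)" for x l
      using ab carrier_matD[OF modes_carrier] by (simp only: index_smult_mat)
    have e': "(x \<cdot>\<^sub>m jw n l (ladder s)) $$ (a, b) = x * jw n l (ladder s) $$ (a, b)" for x l s
      using ab carrier_matD[OF jw_carrier[OF pauli_carrier(4)]] by (simp only: index_smult_mat)
    have "?L $$ (a, b) = (\<Sum>l<n. p (Suc l) * modes n l $$ (a, b)) + (\<Sum>l<n. p (Suc (n + l)) * modes n (n + l) $$ (a, b))"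
      unfolding index_sum_mat[OF ab] e p mult_2 sum_lessThan_add by (rule refl)
    also have "\<dots> = (\<Sum>l<n. p (Suc l) * jw n (Suc l) (ladder True) $$ (a, b)) +
        (\<Sum>l<n. p (n + Suc l) * jw n (Suc l) (ladder False) $$ (a, b))"
      by (simp add: modes_def)
    also have "\<dots> = ?R1 $$ (a, b) + ?R2 $$ (a, b)"
      unfolding index_sum_mat[OF ab] e' One_nat_def sum.atLeast1_atMost_eq by (rule refl)
    finally show "?L $$ (a, b) = (?R1 + ?R2) $$ (a, b)"
      using ab by (simp only: index_add_mat carrier_matD[OF sum_mat_carrier])
  qed (simp_all only: index_add_mat carrier_matD[OF sum_mat_carrier])
  finally show T: ?T unfolding mode .
  have c: "x \<cdot>\<^sub>m jw n m (ladder s) \<in> carrier_mat ?d ?d" for x m s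
    by (intro smult_carrier_mat jw_carrier) simp
  have S: "adj (sum_mat ?d (\<lambda>m. q m \<cdot>\<^sub>m jw n m (ladder s)) {1..n}) =
      sum_mat ?d (\<lambda>m. cnj (q m) \<cdot>\<^sub>m jw n m (ladder (\<not> s))) {1..n}" for q s
    by (subst adj_sum_mat[OF c]) (simp only: adj_smult adj_jw adj_pauli)
  \<comment> \<open>Taking adjoints, instead of reading off row \<open>n + j\<close>, keeps to the
    rows \<open>1\<close>, ..., \<open>n\<close> of the propagator. These are the ones that
    dynamical localization controls.\<close>
  have "jw n j (ladder False) = adj (jw n j (ladder True))"
    by (simp only: adj_jw adj_pauli not_True_eq_False)
  then have "heisenberg ?H t (jw n j (ladder False)) = heisenberg ?H t (adj (jw n j (ladder True)))"
    by (rule arg_cong)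
  also have "\<dots> = adj (heisenberg ?H t (jw n j (ladder True)))"
    by (rule adj_heisenberg[OF xy_hamiltonian_carrier adj_xy_hamiltonian jw_carrier[OF pauli_carrier(4)], symmetric])
  also have "\<dots> = adj (sum_mat ?d (\<lambda>m. p m \<cdot>\<^sub>m jw n m (ladder True)) {1..n}) +
      adj (sum_mat ?d (\<lambda>m. p (n + m) \<cdot>\<^sub>m jw n m (ladder False)) {1..n})"
    unfolding T by (rule adj_add[OF sum_mat_carrier sum_mat_carrier])
  also have "\<dots> = sum_mat ?d (\<lambda>m. cnj (p m) \<cdot>\<^sub>m jw n m (ladder False)) {1..n} +
      sum_mat ?d (\<lambda>m. cnj (p (n + m)) \<cdot>\<^sub>m jw n m (ladder True)) {1..n}"
    unfolding S not_True_eq_False not_False_eq_True by (rule refl)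
  finally show "heisenberg ?H t (jw n j (ladder False)) =
      sum_mat ?d (\<lambda>m. cnj (p m) \<cdot>\<^sub>m jw n m (ladder False)) {1..n} +
      sum_mat ?d (\<lambda>m. cnj (p (n + m)) \<cdot>\<^sub>m jw n m (ladder True)) {1..n}" .
qed

end

section \<open>Commutators with evolved local operators\<close>

definition jw_string :: "nat \<Rightarrow> nat \<Rightarrow> complex mat" where
  "jw_string n j = site_prod n (\<lambda>i. if i < j then pauli_z else 1\<^sub>m 2)"

lemma jw_string_carrier: "jw_string n j \<in> carrier_mat (2 ^ n) (2 ^ n)"
  unfolding jw_string_def by (rule site_prod_carrier) auto

lemma jw_string_1: "jw_string n 1 = 1\<^sub>m (2 ^ n)"
  unfolding jw_string_def site_prod_one[symmetric] by (rule site_prod_cong) auto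

lemma jw_string_Suc:
  assumes "1 \<le> j" "j \<le> n"
  shows "jw_string n (Suc j) = jw_string n j * embed n j j pauli_z"
  unfolding jw_string_def embed_eq_site_prod[OF assms]
  by (subst site_prod_mult) (auto intro!: site_prod_cong)

text \<open>The string is its own inverse, so multiplying by it strips it off and leaves a local
  operator.\<close>

lemma jw_string_mult_jw:
  assumes "x \<in> carrier_mat 2 2" "1 \<le> j" "j \<le> n"
  shows "jw_string n j * jw n j x = embed n j j x"
  unfolding jw_string_def jw_def embed_eq_site_prod[OF assms(2,3)] using assms
  by (subst site_prod_mult) (auto intro!: site_prod_cong)

lemma op_norm_jw_string: "op_norm (jw_string n j) \<le> 1"
proof (rule op_norm_unitary[OF jw_string_carrier])
  have "adj (if i < j then pauli_z else 1\<^sub>m 2) * (if i < j then pauli_z else 1\<^sub>m 2) = 1\<^sub>m 2" for i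
    by (simp only: adj_pauli if_distrib[of adj] pauli_z_square split: if_split) simp
  moreover have "adj (if i < j then pauli_z else 1\<^sub>m 2) \<in> carrier_mat 2 2" for i
    by (intro adj_carrier) simp
  ultimately show "adj (jw_string n j) * jw_string n j = 1\<^sub>m (2 ^ n)"
    unfolding jw_string_def adj_site_prod site_prod_one[symmetric]
    by (subst site_prod_mult) auto
qed

lemma op_norm_embed_pauli_z:
  assumes "1 \<le> j" "j \<le> n"
  shows "op_norm (embed n j j pauli_z) \<le> 1"
proof (rule op_norm_unitary[OF embed_carrier[OF pauli_carrier(3) assms]])
  have "adj (embed n j j pauli_z) = embed n j j pauli_z"
    unfolding embed_eq_site_prod[OF assms] adj_site_prod
    by (simp only: if_distrib[of adj] adj_pauli)
  moreover have "embed n j j pauli_z * embed n j j pauli_z = 1\<^sub>m (2 ^ n)"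
    unfolding embed_eq_site_prod[OF assms] site_prod_one[symmetric]
    by (subst site_prod_mult) (auto intro!: site_prod_cong)
  ultimately show "adj (embed n j j pauli_z) * embed n j j pauli_z = 1\<^sub>m (2 ^ n)" by simp
qed

text \<open>The entry \<open>(r, c)\<close> of \<open>X\<close> reappears in the embedding where
  every site other than \<open>j\<close> is in its first basis state. The coefficients in
  \<open>mat2_eq_ladder\<close> are thereby compared directly with the norm of the operator on the
  chain.\<close>

lemma cmod_index_le_op_norm_embed:
  assumes X: "X \<in> carrier_mat 2 2" and j: "1 \<le> j" "j \<le> n" and rc: "r < 2" "c < 2"
  shows "cmod (X $$ (r, c)) \<le> op_norm (embed n j j X)"
proof -
  let ?N = "2 ^ (n - j) :: nat"
  have "(2::nat) \<le> 2 ^ (j - 1) * 2" by simp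
  then have lt: "r < 2 ^ (j - 1) * 2" "c < 2 ^ (j - 1) * 2" using rc by (meson order_less_le_trans)+
  have "embed n j j X $$ (r * ?N, c * ?N) = kron (1\<^sub>m (2 ^ (j - 1))) X $$ (r, c)"
    unfolding embed_def using X lt by (subst index_kron) auto
  also have "\<dots> = X $$ (r, c)"
    using X lt rc by (subst index_kron) auto
  finally have "X $$ (r, c) = embed n j j X $$ (r * ?N, c * ?N)" by simp
  moreover have "r * ?N < dim_row (embed n j j X)" "c * ?N < dim_col (embed n j j X)"
    using X lt by (auto simp: embed_def)
  ultimately show ?thesis using cmod_index_le_op_norm by metis
qed

context
  fixes \<mu> \<gamma> \<nu> :: "nat \<Rightarrow> real" and n k :: nat and B :: "complex mat" and t :: real
  assumes k: "1 \<le> k" "k \<le> n" and B: "B \<in> local_algebra n k n"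
begin

text \<open>The total propagator weight from site \<open>l\<close> into the sites of
  \<open>B\<close>, through both upper blocks and at the doubled time of
  \<open>heisenberg_ladder\<close>.\<close>

definition spread :: "nat \<Rightarrow> real" where
  "spread l = (\<Sum>m = k..n. cmod (propagator_entry (one_particle \<mu> \<gamma> \<nu> n) l m (2 * t)) +
     cmod (propagator_entry (one_particle \<mu> \<gamma> \<nu> n) l (n + m) (2 * t)))"

text \<open>A seminorm in \<open>X\<close> that is also subadditive on products of contractions; the
  estimates extend it from ladder operators to strings and then to all operators at one
  site.\<close>

definition comm_norm :: "complex mat \<Rightarrow> real" where
  "comm_norm X = op_norm (commutator (heisenberg (xy_hamiltonian \<mu> \<gamma> \<nu> n) t X) B)"

lemma spread_nonneg: "0 \<le> spread l"
  unfolding spread_def by (intro sum_nonneg add_nonneg_nonneg) auto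

lemmas H_facts = xy_hamiltonian_carrier adj_xy_hamiltonian
lemmas B_carrier = local_algebra_carrier[OF B k]
lemmas heis_carrier = heisenberg_carrier[OF H_facts]

lemma comm_norm_add:
  assumes "X \<in> carrier_mat (2 ^ n) (2 ^ n)" "Y \<in> carrier_mat (2 ^ n) (2 ^ n)"
  shows "comm_norm (X + Y) \<le> comm_norm X + comm_norm Y"
  unfolding comm_norm_def heisenberg_add[OF H_facts assms]
  by (intro op_norm_commutator_add[where d = "2 ^ n"] heis_carrier B_carrier assms)

lemma comm_norm_smult:
  assumes "X \<in> carrier_mat (2 ^ n) (2 ^ n)"
  shows "comm_norm (c \<cdot>\<^sub>m X) \<le> cmod c * comm_norm X"
  unfolding comm_norm_def heisenberg_smult[OF H_facts assms]
  by (intro op_norm_commutator_smult[where d = "2 ^ n"] heis_carrier B_carrier assms)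

lemma comm_norm_mult:
  assumes "X \<in> carrier_mat (2 ^ n) (2 ^ n)" "Y \<in> carrier_mat (2 ^ n) (2 ^ n)" "op_norm X \<le> 1" "op_norm Y \<le> 1"
  shows "comm_norm (X * Y) \<le> comm_norm X + comm_norm Y"
  unfolding comm_norm_def heisenberg_mult[OF H_facts assms(1,2)]
  by (intro op_norm_commutator_mult[where d = "2 ^ n"] heis_carrier B_carrier op_norm_heisenberg_le_1[OF H_facts] assms)

lemma comm_norm_one: "comm_norm (1\<^sub>m (2 ^ n)) \<le> 0"
proof -
  have "heisenberg (xy_hamiltonian \<mu> \<gamma> \<nu> n) t (1\<^sub>m (2 ^ n)) = 1\<^sub>m (2 ^ n)"
    unfolding heisenberg_evol[OF H_facts] right_mult_one_mat[OF evol_carrier[OF H_facts]]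
    by (rule evol_inverse[OF H_facts])
  moreover have "commutator (1\<^sub>m (2 ^ n)) B = 0\<^sub>m (2 ^ n) (2 ^ n)"
    unfolding commutator_def left_mult_one_mat[OF B_carrier] right_mult_one_mat[OF B_carrier]
    by (rule minus_r_inv_mat[OF B_carrier])
  ultimately show ?thesis by (simp only: comm_norm_def op_norm_zero)
qed

lemma comm_norm_ladder:
  assumes l: "1 \<le> l" "l \<le> n"
  shows "comm_norm (jw n l (ladder s)) \<le> 2 * op_norm B * spread l"
proof -
  let ?S = "\<lambda>\<alpha> s. sum_mat (2 ^ n) (\<lambda>m. \<alpha> m \<cdot>\<^sub>m jw n m (ladder s)) {1..n}"
  let ?p = "\<lambda>m. propagator_entry (one_particle \<mu> \<gamma> \<nu> n) l m (2 * t)"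
  \<comment> \<open>Only the moduli of the coefficients are prescribed, so that one bound covers a
    ladder operator and its adjoint, whose coefficients are complex conjugates.\<close>
  have bound: "op_norm (commutator (?S \<alpha> s + ?S \<beta> s') B) \<le> 2 * op_norm B * spread l"
    if "\<And>m. cmod (\<alpha> m) = cmod (?p m)" "\<And>m. cmod (\<beta> m) = cmod (?p (n + m))" for \<alpha> \<beta> s s'
  proof -
    have "op_norm (commutator (?S \<alpha> s + ?S \<beta> s') B) \<le> op_norm (commutator (?S \<alpha> s) B) + op_norm (commutator (?S \<beta> s') B)"
      by (rule op_norm_commutator_add[OF sum_mat_carrier sum_mat_carrier B_carrier])
    also have "\<dots> \<le> 2 * op_norm B * (\<Sum>m = k..n. cmod (\<alpha> m)) + 2 * op_norm B * (\<Sum>m = k..n. cmod (\<beta> m))"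
      by (intro add_mono op_norm_commutator_sum_ladder k B)
    also have "\<dots> = 2 * op_norm B * spread l"
      unfolding spread_def that sum.distrib distrib_left by (rule refl)
    finally show ?thesis .
  qed
  show ?thesis
  proof (cases s)
    case True
    then have "s = True" by simp
    then show ?thesis
      unfolding comm_norm_def by (simp only: heisenberg_ladder(1)[OF l] bound)
  next
    case False
    then have "s = False" by simp
    then show ?thesis
      unfolding comm_norm_def by (simp only: heisenberg_ladder(2)[OF l] bound complex_mod_cnj)
  qed
qed

lemma comm_norm_number:
  assumes l: "1 \<le> l" "l \<le> n"
  shows "comm_norm (embed n l l (ladder s * ladder s')) \<le> 4 * op_norm B * spread l"
proof -
  note c = jw_carrier[OF pauli_carrier(4)]
  have "comm_norm (embed n l l (ladder s * ladder s')) \<le> comm_norm (jw n l (ladder s)) + comm_norm (jw n l (ladder s'))"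
    unfolding jw_mult[OF pauli_carrier(4,4) l, symmetric]
    by (intro comm_norm_mult c op_norm_jw_ladder l)
  also have "\<dots> \<le> 2 * op_norm B * spread l + 2 * op_norm B * spread l"
    by (intro add_mono comm_norm_ladder l)
  finally show ?thesis by simp
qed

text \<open>The constant is the prefactor 2 times the 4 of a product of two ladder operators; the
  multiple of the identity contributes nothing.\<close>

lemma comm_norm_pauli_z:
  assumes l: "1 \<le> l" "l \<le> n"
  shows "comm_norm (embed n l l pauli_z) \<le> 8 * op_norm B * spread l"
proof -
  let ?N = "ladder False * ladder True"
  have N: "?N \<in> carrier_mat 2 2" by (rule mult_carrier_mat[of _ 2 2]) simp_all
  note c = embed_carrier[OF N l]
  have "embed n l l pauli_z = 2 \<cdot>\<^sub>m embed n l l ?N + (-1) \<cdot>\<^sub>m 1\<^sub>m (2 ^ n)"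
    unfolding pauli_z_eq_ladder embed_add[OF smult_carrier_mat[OF N] smult_carrier_mat[OF one_carrier_mat] l]
      embed_smult[OF l] embed_one[OF l] by (rule refl)
  then have "comm_norm (embed n l l pauli_z) \<le> comm_norm (2 \<cdot>\<^sub>m embed n l l ?N) + comm_norm ((-1) \<cdot>\<^sub>m 1\<^sub>m (2 ^ n))"
    using comm_norm_add[OF smult_carrier_mat[OF c] smult_carrier_mat[OF one_carrier_mat]] by (simp only:)
  also have "\<dots> \<le> cmod 2 * comm_norm (embed n l l ?N) + cmod (-1) * comm_norm (1\<^sub>m (2 ^ n))"
    by (intro add_mono comm_norm_smult c one_carrier_mat)
  also have "\<dots> \<le> 2 * (4 * op_norm B * spread l) + 0"
    using comm_norm_number[OF l, of False True] comm_norm_one by (intro add_mono mult_mono) (auto simp: comm_norm_def)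
  finally show ?thesis by simp
qed

text \<open>The string is charged 8 for each of its sites. This is the origin of the sum over
  sources to the left of \<open>j\<close>, and so of the second geometric series.\<close>

lemma comm_norm_jw_string:
  assumes "1 \<le> j" "j \<le> n"
  shows "comm_norm (jw_string n j) \<le> (\<Sum>l = 1..<j. 8 * op_norm B * spread l)"
  using assms
proof (induction j rule: dec_induct)
  case base
  then show ?case unfolding jw_string_1 using comm_norm_one by simp
next
  case (step j)
  then have j: "1 \<le> j" "j \<le> n" by auto
  have "comm_norm (jw_string n (Suc j)) \<le> comm_norm (jw_string n j) + comm_norm (embed n j j pauli_z)"
    unfolding jw_string_Suc[OF j]
    by (intro comm_norm_mult jw_string_carrier embed_carrier op_norm_jw_string op_norm_embed_pauli_z j pauli_carrier)
  also have "\<dots> \<le> (\<Sum>l = 1..<j. 8 * op_norm B * spread l) + 8 * op_norm B * spread j"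
    using step j by (intro add_mono comm_norm_pauli_z) auto
  also have "\<dots> = (\<Sum>l = 1..<Suc j. 8 * op_norm B * spread l)"
    using j by simp
  finally show ?case .
qed

text \<open>In the matrix unit expansion the two diagonal units are local products of two ladder
  operators and cost 4 each at \<open>j\<close>. The two off-diagonal units need the string and cost
  8 for each \<open>l < j\<close> and 2 at \<open>j\<close>. The totals are 16 for each
  \<open>l < j\<close> and 12 at \<open>j\<close>, rounded up to 16 throughout.\<close>

lemma comm_norm_site:
  assumes X: "X \<in> carrier_mat 2 2" and j: "1 \<le> j" "j \<le> n"
  shows "comm_norm (embed n j j X) \<le> 16 * op_norm (embed n j j X) * op_norm B * (\<Sum>l = 1..j. spread l)"
proof -
  let ?a = "op_norm (embed n j j X)"
  let ?s = "\<Sum>l = 1..<j. spread l"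
  let ?e = "embed n j j"
  let ?N = "ladder False * ladder True" and ?N' = "ladder True * ladder False"
  have N: "?N \<in> carrier_mat 2 2" "?N' \<in> carrier_mat 2 2" by (rule mult_carrier_mat[of _ 2 2]; simp)+
  note c = embed_carrier[OF _ j]
  note c = c[OF N(1)] c[OF N(2)] c[OF pauli_carrier(4)]
  note sm = smult_carrier_mat
  have ladder: "comm_norm (?e (ladder s)) \<le> 8 * op_norm B * ?s + 2 * op_norm B * spread j" for s
  proof -
    have "comm_norm (?e (ladder s)) \<le> comm_norm (jw_string n j) + comm_norm (jw n j (ladder s))"
      unfolding jw_string_mult_jw[OF pauli_carrier(4) j, symmetric]
      by (intro comm_norm_mult jw_string_carrier jw_carrier op_norm_jw_string op_norm_jw_ladder j pauli_carrier)
    also have "\<dots> \<le> (\<Sum>l = 1..<j. 8 * op_norm B * spread l) + 2 * op_norm B * spread j"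
      by (intro add_mono comm_norm_jw_string comm_norm_ladder j)
    finally show ?thesis by (simp add: sum_distrib_left)
  qed
  have entry: "comm_norm (X $$ (r, q) \<cdot>\<^sub>m ?e Y) \<le> ?a * K"
    if "comm_norm (?e Y) \<le> K" "?e Y \<in> carrier_mat (2 ^ n) (2 ^ n)" "r < 2" "q < 2" for Y K r q
  proof -
    have "comm_norm (X $$ (r, q) \<cdot>\<^sub>m ?e Y) \<le> cmod (X $$ (r, q)) * comm_norm (?e Y)"
      by (rule comm_norm_smult[OF that(2)])
    also have "\<dots> \<le> ?a * K"
      using that cmod_index_le_op_norm_embed[OF X j that(3,4)]
      by (intro mult_mono) (auto simp: comm_norm_def)
    finally show ?thesis .
  qed
  have "?e X = (X $$ (0, 0) \<cdot>\<^sub>m ?e ?N + X $$ (1, 1) \<cdot>\<^sub>m ?e ?N') +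
      (X $$ (1, 0) \<cdot>\<^sub>m ?e (ladder True) + X $$ (0, 1) \<cdot>\<^sub>m ?e (ladder False))"
    unfolding embed_smult[OF j, symmetric]
      embed_add[OF sm[OF N(1)] sm[OF N(2)] j, symmetric]
      embed_add[OF sm[OF pauli_carrier(4)] sm[OF pauli_carrier(4)] j, symmetric]
      embed_add[OF add_carrier_mat[OF sm[OF N(2)]] add_carrier_mat[OF sm[OF pauli_carrier(4)]] j, symmetric]
    by (rule arg_cong[OF mat2_eq_ladder[OF X]])
  then have "comm_norm (?e X) \<le> (comm_norm (X $$ (0, 0) \<cdot>\<^sub>m ?e ?N) + comm_norm (X $$ (1, 1) \<cdot>\<^sub>m ?e ?N')) +
      (comm_norm (X $$ (1, 0) \<cdot>\<^sub>m ?e (ladder True)) + comm_norm (X $$ (0, 1) \<cdot>\<^sub>m ?e (ladder False)))"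
    by (simp only:) (intro order_trans[OF comm_norm_add] add_mono comm_norm_add add_carrier_mat sm c)
  also have "\<dots> \<le> (?a * (4 * op_norm B * spread j) + ?a * (4 * op_norm B * spread j)) +
      (?a * (8 * op_norm B * ?s + 2 * op_norm B * spread j) + ?a * (8 * op_norm B * ?s + 2 * op_norm B * spread j))"
    by (intro add_mono entry comm_norm_number[OF j] ladder c) auto
  also have "\<dots> = 16 * ?a * op_norm B * ?s + 12 * (?a * op_norm B * spread j)"
    by (simp add: algebra_simps)
  also have "\<dots> \<le> 16 * ?a * op_norm B * ?s + 16 * (?a * op_norm B * spread j)"
    by (intro add_left_mono mult_right_mono mult_nonneg_nonneg spread_nonneg op_norm_nonneg) auto
  also have "\<dots> = 16 * ?a * op_norm B * (\<Sum>l = 1..j. spread l)"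
  proof -
    have "(\<Sum>l = 1..j. spread l) = ?s + spread j"
      using j by (simp add: sum.last_plus add.commute)
    then show ?thesis by (simp only:) (simp add: algebra_simps)
  qed
  finally show ?thesis .
qed

end

section \<open>Expectations\<close>

lemma pow_mat_smult:
  fixes A :: "'a::comm_ring_1 mat"
  assumes A: "A \<in> carrier_mat d d"
  shows "(c \<cdot>\<^sub>m A) ^\<^sub>m i = c ^ i \<cdot>\<^sub>m A ^\<^sub>m i"
proof (induction i)
  case 0
  show ?case using A by (auto intro!: eq_matI)
next
  case (Suc i)
  have p: "A ^\<^sub>m i \<in> carrier_mat d d" using A by (induction i) auto
  have "(c \<cdot>\<^sub>m A) ^\<^sub>m Suc i = (c ^ i \<cdot>\<^sub>m A ^\<^sub>m i) * (c \<cdot>\<^sub>m A)"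
    using Suc by simp
  also have "\<dots> = c ^ i \<cdot>\<^sub>m (c \<cdot>\<^sub>m (A ^\<^sub>m i * A))"
    unfolding mult_smult_assoc_mat[OF p smult_carrier_mat[OF A]] mult_smult_distrib[OF p A] by (rule refl)
  also have "\<dots> = c ^ Suc i \<cdot>\<^sub>m A ^\<^sub>m Suc i"
    by (rule eq_matI) auto
  finally show ?case .
qed

text \<open>As a function of \<open>z\<close> the entry is a power series that converges
  everywhere.\<close>

lemma continuous_mat_exp_index:
  fixes A :: "complex mat"
  assumes A: "A \<in> carrier_mat d d" and ij: "i < d" "j < d"
  shows "isCont (\<lambda>z. mat_exp (z \<cdot>\<^sub>m A) $$ (i, j)) z"
proof -
  have eq: "((w \<cdot>\<^sub>m A) ^\<^sub>m m) $$ (i, j) / fact m = ((A ^\<^sub>m m) $$ (i, j) / fact m) * w ^ m" for w m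
    unfolding pow_mat_smult[OF A] using ij carrier_matD[OF pow_mat_carrier[OF A]] by simp
  have sums: "(\<lambda>m. ((A ^\<^sub>m m) $$ (i, j) / fact m) * w ^ m) sums mat_exp (w \<cdot>\<^sub>m A) $$ (i, j)" for w
    unfolding eq[symmetric] by (rule mat_exp_sums[OF smult_carrier_mat[OF A] ij])
  have "isCont (\<lambda>w. \<Sum>m. ((A ^\<^sub>m m) $$ (i, j) / fact m) * w ^ m) z"
    by (rule isCont_powser_converges_everywhere) (rule sums_summable[OF sums])
  moreover have "(\<lambda>w. \<Sum>m. ((A ^\<^sub>m m) $$ (i, j) / fact m) * w ^ m) = (\<lambda>w. mat_exp (w \<cdot>\<^sub>m A) $$ (i, j))"
    by (rule ext) (rule sums_unique[OF sums, symmetric])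
  ultimately show ?thesis by simp
qed

lemma continuous_propagator_entry:
  assumes M: "M \<in> carrier_mat d d" and ij: "1 \<le> i" "i \<le> d" "1 \<le> j" "j \<le> d"
  shows "continuous_on UNIV (propagator_entry M i j)"
proof -
  have "continuous_on UNIV ((\<lambda>z. mat_exp (z \<cdot>\<^sub>m map_mat complex_of_real M) $$ (i - 1, j - 1)) \<circ> (\<lambda>t. - \<i> * complex_of_real t))"
    using M ij
    by (intro continuous_on_compose continuous_intros continuous_at_imp_continuous_on ballI continuous_mat_exp_index[of _ d]) auto
  then show ?thesis by (simp add: o_def propagator_entry_def[abs_def])
qed

text \<open>By continuity, the times at which \<open>f\<close> stays below its rational supremum
  form a closed set, and this set contains the dense set of rationals. An uncountable supremum thus
  becomes a countable one, for which measurability is available.\<close>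

lemma SUP_eq_SUP_Rats:
  fixes f :: "real \<Rightarrow> ennreal"
  assumes "continuous_on UNIV f"
  shows "(SUP t. f t) = (SUP t\<in>\<rat>. f t)"
proof (rule antisym)
  have "closed {t. f t \<le> (SUP t\<in>\<rat>. f t)}"
    by (intro closed_Collect_le assms continuous_on_const)
  then have "closure \<rat> \<subseteq> {t. f t \<le> (SUP t\<in>\<rat>. f t)}"
    by (rule closure_minimal[rotated]) (auto intro: SUP_upper)
  then show "(SUP t. f t) \<le> (SUP t\<in>\<rat>. f t)"
    by (auto simp: Rats_closure_real intro!: SUP_least)
qed (auto intro: SUP_subset_mono)

lemma measurable_pow_mat_index:
  fixes A :: "'w \<Rightarrow> complex mat"
  assumes A: "\<And>\<omega>. A \<omega> \<in> carrier_mat d d"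
    and meas: "\<And>i j. i < d \<Longrightarrow> j < d \<Longrightarrow> (\<lambda>\<omega>. A \<omega> $$ (i, j)) \<in> borel_measurable P"
    and ij: "i < d" "j < d"
  shows "(\<lambda>\<omega>. (A \<omega> ^\<^sub>m m) $$ (i, j)) \<in> borel_measurable P"
  using ij
proof (induction m arbitrary: i j)
  case 0
  then show ?case using carrier_matD[OF A] by simp
next
  case (Suc m)
  have "(\<lambda>\<omega>. (A \<omega> ^\<^sub>m Suc m) $$ (i, j)) = (\<lambda>\<omega>. \<Sum>l<d. (A \<omega> ^\<^sub>m m) $$ (i, l) * A \<omega> $$ (l, j))"
    using mat_mult_index[OF pow_mat_carrier[OF A] A Suc.prems] by simp
  also have "\<dots> \<in> borel_measurable P"
    using Suc meas by (intro borel_measurable_sum borel_measurable_times) auto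
  finally show ?case .
qed

lemma measurable_mat_exp_index:
  fixes A :: "'w \<Rightarrow> complex mat"
  assumes A: "\<And>\<omega>. A \<omega> \<in> carrier_mat d d"
    and meas: "\<And>i j. i < d \<Longrightarrow> j < d \<Longrightarrow> (\<lambda>\<omega>. A \<omega> $$ (i, j)) \<in> borel_measurable P"
    and ij: "i < d" "j < d"
  shows "(\<lambda>\<omega>. mat_exp (A \<omega>) $$ (i, j)) \<in> borel_measurable P"
proof (rule borel_measurable_LIMSEQ_metric)
  show "(\<lambda>\<omega>. \<Sum>m<k. (A \<omega> ^\<^sub>m m) $$ (i, j) / fact m) \<in> borel_measurable P" for k
    by (intro borel_measurable_sum borel_measurable_divide measurable_pow_mat_index[OF A meas ij] borel_measurable_const)
  show "(\<lambda>k. \<Sum>m<k. (A \<omega> ^\<^sub>m m) $$ (i, j) / fact m) \<longlonglongrightarrow> mat_exp (A \<omega>) $$ (i, j)" for \<omega>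
    using mat_exp_sums[OF A ij] by (simp add: sums_def)
qed

lemma measurable_SUP_propagator_entry:
  assumes M: "\<And>\<omega>. M \<omega> \<in> carrier_mat d d"
    and meas: "\<And>i j. i < d \<Longrightarrow> j < d \<Longrightarrow> (\<lambda>\<omega>. M \<omega> $$ (i, j)) \<in> borel_measurable P"
    and ij: "1 \<le> i" "i \<le> d" "1 \<le> j" "j \<le> d"
  shows "(\<lambda>\<omega>. SUP t. ennreal (cmod (propagator_entry (M \<omega>) i j t))) \<in> borel_measurable P"
proof -
  have "(\<lambda>\<omega>. propagator_entry (M \<omega>) i j t) \<in> borel_measurable P" for t
    unfolding propagator_entry_def
  proof (rule measurable_mat_exp_index)
    show "(\<lambda>\<omega>. ((- \<i> * complex_of_real t) \<cdot>\<^sub>m map_mat complex_of_real (M \<omega>)) $$ (a, b)) \<in> borel_measurable P"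
      if "a < d" "b < d" for a b
    proof -
      have "(\<lambda>\<omega>. ((- \<i> * complex_of_real t) \<cdot>\<^sub>m map_mat complex_of_real (M \<omega>)) $$ (a, b)) =
          (\<lambda>\<omega>. (- \<i> * complex_of_real t) * complex_of_real (M \<omega> $$ (a, b)))"
        using that carrier_matD[OF M] by simp
      then show ?thesis using meas[OF that] by simp
    qed
  qed (use M ij in auto)
  then have "(\<lambda>\<omega>. SUP t\<in>\<rat>. ennreal (cmod (propagator_entry (M \<omega>) i j t))) \<in> borel_measurable P"
    by (intro borel_measurable_SUP countable_rat) measurable
  moreover have "(SUP t. ennreal (cmod (propagator_entry (M \<omega>) i j t))) =
      (SUP t\<in>\<rat>. ennreal (cmod (propagator_entry (M \<omega>) i j t)))" for \<omega>
    by (intro SUP_eq_SUP_Rats continuous_on_ennreal continuous_on_norm continuous_propagator_entry[OF M ij])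
  ultimately show ?thesis by simp
qed

lemma measurable_one_particle_index:
  fixes \<mu> \<gamma> \<nu> :: "nat \<Rightarrow> 'w \<Rightarrow> real"
  assumes meas: "\<And>j. 1 \<le> j \<Longrightarrow> \<mu> j \<in> borel_measurable P"
    "\<And>j. 1 \<le> j \<Longrightarrow> \<gamma> j \<in> borel_measurable P"
    "\<And>j. 1 \<le> j \<Longrightarrow> \<nu> j \<in> borel_measurable P"
    and ab: "a < 2 * n" "b < 2 * n"
  shows "(\<lambda>\<omega>. one_particle (\<lambda>j. \<mu> j \<omega>) (\<lambda>j. \<gamma> j \<omega>) (\<lambda>j. \<nu> j \<omega>) n $$ (a, b)) \<in> borel_measurable P"
proof -
  have A: "(\<lambda>\<omega>. block_A (\<lambda>j. \<mu> j \<omega>) (\<lambda>j. \<nu> j \<omega>) n $$ (i, j)) \<in> borel_measurable P" if "i < n" "j < n" for i j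
    unfolding block_A_def index_mat(1)[OF that] prod.case
    by (intro measurable_If borel_measurable_uminus borel_measurable_const meas) auto
  have B: "(\<lambda>\<omega>. block_B (\<lambda>j. \<mu> j \<omega>) (\<lambda>j. \<gamma> j \<omega>) n $$ (i, j)) \<in> borel_measurable P" if "i < n" "j < n" for i j
    unfolding block_B_def index_mat(1)[OF that] prod.case
    by (intro measurable_If borel_measurable_times borel_measurable_uminus borel_measurable_const meas) auto
  define i j where "i = (if a < n then a else a - n)" and "j = (if b < n then b else b - n)"
  then have ij: "i < n" "j < n" "a = i \<or> a = n + i" "b = j \<or> b = n + j"
    using ab by auto
  then show ?thesis
    using A[OF ij(1,2)] B[OF ij(1,2)] by (auto simp: one_particle_index)
qed

section \<open>Geometric sums\<close>

lemma sum_power_le_inverse: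
  fixes q :: real
  assumes "0 \<le> q" "q < 1"
  shows "(\<Sum>i<m. q ^ i) \<le> 1 / (1 - q)"
  using assms sum_le_suminf[of "\<lambda>i. q ^ i" "{..<m}"] by (simp add: suminf_geometric summable_geometric)

text \<open>For \<open>l \<le> j < k \<le> m\<close> the distance from \<open>l\<close> to
  \<open>m\<close> is the sum of \<open>k - j\<close>, \<open>j - l\<close> and
  \<open>m - k\<close>. The exponential factorises accordingly, and each of the two sums is a
  partial geometric series.\<close>

lemma double_geometric_sum_le:
  fixes \<eta> :: real
  assumes \<eta>: "0 < \<eta>" and jk: "j < k" "k \<le> n"
  shows "(\<Sum>l = 1..j. \<Sum>m = k..n. exp (- \<eta> * \<bar>real l - real m\<bar>)) \<le>
    exp (- \<eta> * \<bar>real k - real j\<bar>) / (1 - exp (- \<eta>))\<^sup>2"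
proof -
  let ?q = "exp (- \<eta>)"
  have q: "0 \<le> ?q" "?q < 1" using \<eta> by auto
  have "(\<Sum>l = 1..j. \<Sum>m = k..n. exp (- \<eta> * \<bar>real l - real m\<bar>)) =
      (\<Sum>l = 1..j. \<Sum>m = k..n. exp (- \<eta> * \<bar>real k - real j\<bar>) * (?q ^ (j - l) * ?q ^ (m - k)))"
  proof (intro sum.cong refl)
    fix l m assume "l \<in> {1..j}" "m \<in> {k..n}"
    then have "- \<eta> * \<bar>real l - real m\<bar> = - \<eta> * \<bar>real k - real j\<bar> + (real (j - l) * - \<eta> + real (m - k) * - \<eta>)"
      using jk by (simp add: of_nat_diff abs_if algebra_simps)
    then show "exp (- \<eta> * \<bar>real l - real m\<bar>) = exp (- \<eta> * \<bar>real k - real j\<bar>) * (?q ^ (j - l) * ?q ^ (m - k))"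
      by (simp only: exp_add exp_of_nat_mult)
  qed
  also have "\<dots> = exp (- \<eta> * \<bar>real k - real j\<bar>) * ((\<Sum>l = 1..j. ?q ^ (j - l)) * (\<Sum>m = k..n. ?q ^ (m - k)))"
    unfolding sum_product unfolding sum_distrib_left by (rule refl)
  also have "(\<Sum>l = 1..j. ?q ^ (j - l)) = (\<Sum>i<j. ?q ^ i)"
    unfolding One_nat_def sum.atLeast1_atMost_eq by (rule sum.nat_diff_reindex)
  also have "(\<Sum>m = k..n. ?q ^ (m - k)) = (\<Sum>i<Suc (n - k). ?q ^ i)"
    using jk by (simp only: sum.atLeastAtMost_shift_0 o_def add_diff_cancel_left' atLeast0AtMost lessThan_Suc_atMost)
  also have "exp (- \<eta> * \<bar>real k - real j\<bar>) * ((\<Sum>i<j. ?q ^ i) * (\<Sum>i<Suc (n - k). ?q ^ i)) \<le>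
      exp (- \<eta> * \<bar>real k - real j\<bar>) * ((1 / (1 - ?q)) * (1 / (1 - ?q)))"
    by (intro mult_left_mono mult_mono sum_power_le_inverse q sum_nonneg) (use q in auto)
  finally show ?thesis by (simp add: power2_eq_square)
qed

theorem theorem3p2:
  fixes P :: "'w measure"
    and \<mu> \<gamma> \<nu> :: "nat \<Rightarrow> 'w \<Rightarrow> real"
    and C \<eta> :: real
    and H :: "nat \<Rightarrow> 'w \<Rightarrow> complex mat"
    and M :: "nat \<Rightarrow> 'w \<Rightarrow> real mat"
  assumes "prob_space P"
    and "\<And>j. 1 \<le> j \<Longrightarrow> \<mu> j \<in> borel_measurable P"
    and "\<And>j. 1 \<le> j \<Longrightarrow> \<gamma> j \<in> borel_measurable P"
    and "\<And>j. 1 \<le> j \<Longrightarrow> \<nu> j \<in> borel_measurable P"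
    and "\<And>j. 1 \<le> j \<Longrightarrow> AE \<omega> in P. \<mu> j \<omega> \<noteq> 0"
    and H: "H = (\<lambda>n \<omega>. xy_hamiltonian (\<lambda>j. \<mu> j \<omega>) (\<lambda>j. \<gamma> j \<omega>) (\<lambda>j. \<nu> j \<omega>) n)"
    and M: "M = (\<lambda>n \<omega>. one_particle (\<lambda>j. \<mu> j \<omega>) (\<lambda>j. \<gamma> j \<omega>) (\<lambda>j. \<nu> j \<omega>) n)"
    and "dynamically_localized P M C \<eta>"
  shows "(\<exists>C' > 0. \<exists>\<eta>' > 0. commutator_bound P H C' \<eta>') \<and>
    commutator_bound P H (96 * C / (1 - exp (- \<eta>))\<^sup>2) \<eta>"
proof -
  let ?C' = "96 * C / (1 - exp (- \<eta>))\<^sup>2"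
  have C: "0 < C" and \<eta>: "0 < \<eta>"
    and loc: "\<And>n l m. 1 \<le> l \<Longrightarrow> l \<le> n \<Longrightarrow> 1 \<le> m \<Longrightarrow> m \<le> n \<Longrightarrow>
      (\<integral>\<^sup>+\<omega>. (SUP t. ennreal (cmod (propagator_entry (M n \<omega>) l m t))) +
        (SUP t. ennreal (cmod (propagator_entry (M n \<omega>) l (n + m) t))) \<partial>P)
      \<le> ennreal (C * exp (- \<eta> * \<bar>real l - real m\<bar>))"
    using assms(8) unfolding dynamically_localized_def by auto
  have "commutator_bound P H ?C' \<eta>"
    unfolding commutator_bound_def
  proof (intro allI impI ballI)
    fix j k n A B
    assume jkn: "1 \<le> j \<and> j < k \<and> k \<le> n" and "A \<in> local_algebra n j j" and B: "B \<in> local_algebra n k n"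
    then obtain X where X: "X \<in> carrier_mat 2 2" and A: "A = embed n j j X"
      by (auto simp: local_algebra_def)
    have j: "1 \<le> j" "j \<le> n" and k: "1 \<le> k" "k \<le> n" using jkn by auto
    let ?K = "16 * op_norm A * op_norm B"
    define F where "F l m \<omega> = (SUP t. ennreal (cmod (propagator_entry (M n \<omega>) l m t))) +
        (SUP t. ennreal (cmod (propagator_entry (M n \<omega>) l (n + m) t)))" for l m \<omega>
    have K: "0 \<le> ?K" by simp
    \<comment> \<open>Needed to exchange the expectation with the two finite sums.\<close>
    have F_meas: "F l m \<in> borel_measurable P" if "l \<in> {1..j}" "m \<in> {k..n}" for l m
      unfolding F_def M using that jkn
      by (intro borel_measurable_add measurable_SUP_propagator_entry[OF one_particle_carrier]
          measurable_one_particle_index assms) auto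
    have pointwise: "(SUP t. ennreal (op_norm (commutator (heisenberg (H n \<omega>) t A) B))) \<le>
        ennreal ?K * (\<Sum>l = 1..j. \<Sum>m = k..n. F l m \<omega>)" for \<omega>
    proof (rule SUP_least)
      fix t :: real
      let ?p = "\<lambda>l m. propagator_entry (M n \<omega>) l m (2 * t)"
      have "op_norm (commutator (heisenberg (H n \<omega>) t A) B) \<le>
          ?K * (\<Sum>l = 1..j. \<Sum>m = k..n. cmod (?p l m) + cmod (?p l (n + m)))"
        using comm_norm_site[OF k B X j] unfolding comm_norm_def[OF k B] spread_def[OF k B] H M A .
      then have "ennreal (op_norm (commutator (heisenberg (H n \<omega>) t A) B)) \<le>
          ennreal (?K * (\<Sum>l = 1..j. \<Sum>m = k..n. cmod (?p l m) + cmod (?p l (n + m))))"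
        by (rule ennreal_leI)
      also have "\<dots> = ennreal ?K * (\<Sum>l = 1..j. \<Sum>m = k..n. ennreal (cmod (?p l m)) + ennreal (cmod (?p l (n + m))))"
        by (simp add: ennreal_mult sum_nonneg ennreal_plus[symmetric] sum_ennreal del: ennreal_plus)
      \<comment> \<open>Every modulus at time \<open>2 t\<close> is one of the values in the
        supremum over all times, so the doubled time costs nothing and the bound no longer depends
        on \<open>t\<close>.\<close>
      also have "\<dots> \<le> ennreal ?K * (\<Sum>l = 1..j. \<Sum>m = k..n. F l m \<omega>)"
        unfolding F_def by (intro mult_left_mono sum_mono add_mono SUP_upper) auto
      finally show "ennreal (op_norm (commutator (heisenberg (H n \<omega>) t A) B)) \<le> \<dots>" .
    qed
    \<comment> \<open>Monotonicity of the nonnegative integral holds for arbitrary functions, so the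
      supremum of the commutator norms enters only through its pointwise bound.\<close>
    have "(\<integral>\<^sup>+\<omega>. (SUP t. ennreal (op_norm (commutator (heisenberg (H n \<omega>) t A) B))) \<partial>P) \<le>
        (\<integral>\<^sup>+\<omega>. ennreal ?K * (\<Sum>l = 1..j. \<Sum>m = k..n. F l m \<omega>) \<partial>P)"
      by (intro nn_integral_mono pointwise)
    also have "\<dots> = ennreal ?K * (\<Sum>l = 1..j. \<Sum>m = k..n. \<integral>\<^sup>+\<omega>. F l m \<omega> \<partial>P)"
    proof -
      have "(\<integral>\<^sup>+\<omega>. (\<Sum>l = 1..j. \<Sum>m = k..n. F l m \<omega>) \<partial>P) = (\<Sum>l = 1..j. \<integral>\<^sup>+\<omega>. (\<Sum>m = k..n. F l m \<omega>) \<partial>P)"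
        by (intro nn_integral_sum borel_measurable_sum F_meas)
      also have "\<dots> = (\<Sum>l = 1..j. \<Sum>m = k..n. \<integral>\<^sup>+\<omega>. F l m \<omega> \<partial>P)"
        by (intro sum.cong refl nn_integral_sum F_meas)
      finally show ?thesis
        by (subst nn_integral_cmult) (intro borel_measurable_sum F_meas, simp_all)
    qed
    also have "\<dots> \<le> ennreal ?K * (\<Sum>l = 1..j. \<Sum>m = k..n. ennreal (C * exp (- \<eta> * \<bar>real l - real m\<bar>)))"
      unfolding F_def using jkn by (intro mult_left_mono sum_mono loc) auto
    also have "\<dots> = ennreal (?K * (C * (\<Sum>l = 1..j. \<Sum>m = k..n. exp (- \<eta> * \<bar>real l - real m\<bar>))))"
    proof -
      have "(\<Sum>l = 1..j. \<Sum>m = k..n. ennreal (C * exp (- \<eta> * \<bar>real l - real m\<bar>))) =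
          ennreal (\<Sum>l = 1..j. \<Sum>m = k..n. C * exp (- \<eta> * \<bar>real l - real m\<bar>))"
        using C by (simp add: sum_nonneg)
      also have "(\<Sum>l = 1..j. \<Sum>m = k..n. C * exp (- \<eta> * \<bar>real l - real m\<bar>)) =
          C * (\<Sum>l = 1..j. \<Sum>m = k..n. exp (- \<eta> * \<bar>real l - real m\<bar>))"
        unfolding sum_distrib_left by (rule refl)
      finally show ?thesis
        using C by (simp only:) (rule ennreal_mult[symmetric, OF K], simp add: sum_nonneg)
    qed
    also have "\<dots> \<le> ennreal (?C' * op_norm A * op_norm B * exp (- \<eta> * \<bar>real k - real j\<bar>))"
    proof (rule ennreal_leI)
      let ?E = "exp (- \<eta> * \<bar>real k - real j\<bar>) / (1 - exp (- \<eta>))\<^sup>2"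
      have "?K * (C * (\<Sum>l = 1..j. \<Sum>m = k..n. exp (- \<eta> * \<bar>real l - real m\<bar>))) \<le> ?K * (C * ?E)"
        using C K jkn by (intro mult_left_mono double_geometric_sum_le \<eta>) auto
      \<comment> \<open>The estimate at one site gives the factor 16, which is enlarged here to the
        96 of the claim.\<close>
      also have "\<dots> \<le> 96 * (op_norm A * op_norm B * (C * ?E))"
      proof -
        have "0 \<le> op_norm A * op_norm B * (C * ?E)" using C by simp
        moreover have "16 * y \<le> 96 * y" if "0 \<le> y" for y :: real using that by simp
        ultimately show ?thesis unfolding mult.assoc by blast
      qed
      also have "\<dots> = ?C' * op_norm A * op_norm B * exp (- \<eta> * \<bar>real k - real j\<bar>)"
        by (simp add: field_simps)
      finally show "?K * (C * (\<Sum>l = 1..j. \<Sum>m = k..n. exp (- \<eta> * \<bar>real l - real m\<bar>))) \<le>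
          ?C' * op_norm A * op_norm B * exp (- \<eta> * \<bar>real k - real j\<bar>)" .
    qed
    finally show "(\<integral>\<^sup>+\<omega>. (SUP t. ennreal (op_norm (commutator (heisenberg (H n \<omega>) t A) B))) \<partial>P)
        \<le> ennreal (?C' * op_norm A * op_norm B * exp (- \<eta> * \<bar>real k - real j\<bar>))" .
  qed
  moreover have "0 < ?C'" using C \<eta> by simp
  ultimately show ?thesis using \<eta> by blast
qed

end
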